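(* Let $n\ge 2$ and $1\leq p \leq n-1$. Let $\mathbf{x} =(x_1, \dots, x_p)\in \mathbb{R}^{(n,p)}$, with $x_1, \dots, x_p$ linearly independent vectors in $\mathbb{R}^n$, be such that $h(\mathbf{x})<\frac{n(n-p)}{np-1}$, and let $\mathbf{y} \in \mathbb{R}^{(n,p)}$. Let $$\varphi_0=\frac{p}{n-p}\, h(\mathbf{x})-1 \quad\text{and}\quad \psi_0=\frac{p}{n-p}\cdot\frac{1+n(n-p)\varphi_0}{1-(np-1)\varphi_0}.$$ Then for any $\psi >\psi_0$ and any $\epsilon \in (0,1)$ there exists a $\gamma \in \Gamma$ such that $$\|\gamma \mathbf{x} -\mathbf{y}\| <\epsilon \quad\text{and}\quad \|\gamma\| <\epsilon^{-\psi}.$$ Consequently, if $\mathbf{y} \notin \Gamma \mathbf{x}=\{\gamma\mathbf{x}\mid\gamma\in\Gamma\}$, then for all $\rho <1/\psi_0$ there exist infinitely many $\gamma \in \Gamma$ such that $\|\gamma \mathbf{x} -\mathbf{y}\| < \|\gamma\|^{-\rho}$.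
   Context: $\mathcal{M}(n,\mathbb{Z})$ is the ring of $n\times n$ matrices with integer entries, and $\Gamma$ is the multiplicative semigroup of all $n\times n$ matrices with integer entries and positive determinant. $\mathbb{R}^{(n,p)}=\mathbb{R}^n\oplus\cdots\oplus\mathbb{R}^n$ ($p$ copies), i.e. $p$-tuples of column vectors in $\mathbb{R}^n$ (equivalently real $n\times p$ matrices). For an $n\times n$ matrix $\xi$ and $\mathbf{x}=(x_1,\dots,x_p)\in\mathbb{R}^{(n,p)}$, $\xi\mathbf{x}=(\xi x_1,\dots,\xi x_p)$. The norm $\|\cdot\|$ of an element of $\mathbb{R}^{(n,p)}$ or of an $n\times n$ matrix is the maximum of the absolute values of its entries. The homogeneous exponent $h(\mathbf{x})$ of $\mathbf{x}\in\mathbb{R}^{(n,p)}$ is the infimum of all $u$ for which there exists $c>0$ such that $\|\omega\mathbf{x}\|>c\|\omega\|^{-u}$ for all $\omega\in\mathcal{M}(n,\mathbb{Z})\setminus\{0\}$.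
   Formalization: The first claim is proved for all sufficiently small ε (ε < ε₀, with ε₀ ∈ (0,1] depending on x, y, ψ) instead of every ε ∈ (0,1); as printed it is false, since for fixed ε only finitely many γ have ‖γ‖ < ε^{-ψ}, so a far-away y cannot be approximated. *)

theory Defs
  imports "HOL-Analysis.Analysis"
begin

text \<open>
  An element \<open>(x\<^sub>1, \<dots>, x\<^sub>p)\<close> of \<open>\<real>\<^bsup>(n,p)\<^esup>\<close> is the \<open>n \<times> p\<close> matrix with columns \<open>x\<^sub>1, \<dots>, x\<^sub>p\<close>, of type
  \<^typ>\<open>real ^ 'p ^ 'n\<close>, so that \<open>\<xi> x = (\<xi> x\<^sub>1, \<dots>, \<xi> x\<^sub>p)\<close> is the matrix product \<open>\<xi> ** x\<close>.
  The norm is the library's \<^const>\<open>infnorm\<close>, which on matrices is the largest absolute value of an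
  entry:
\<close>

lemma infnorm_matrix_eq_Max:
  fixes A :: "real ^ 'm ^ 'n"
  shows "infnorm A = Max (range (\<lambda>(i, j). \<bar>A $ i $ j\<bar>))"
proof -
  have "{\<bar>A \<bullet> b\<bar> | b. b \<in> Basis} = range (\<lambda>(i, j). \<bar>A $ i $ j\<bar>)"
    by (force simp: Basis_vec_def inner_axis)
  thus ?thesis
    unfolding infnorm_def by (simp add: cSup_eq_Max)
qed

definition int_matrices :: "(real ^ 'n ^ 'n) set" where
  "int_matrices = {\<omega>. \<forall>i j. \<omega> $ i $ j \<in> \<int>}"

definition \<Gamma> :: "(real ^ 'n ^ 'n) set" where
  "\<Gamma> = {\<gamma> \<in> int_matrices. det \<gamma> > 0}"

definition lin_indep_columns :: "real ^ 'p ^ 'n \<Rightarrow> bool" where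
  "lin_indep_columns x \<longleftrightarrow> inj (\<lambda>j. column j x) \<and> independent (range (\<lambda>j. column j x))"

text \<open>
  The infimum is taken in \<^typ>\<open>ereal\<close>, so that the exponent is \<open>\<infinity>\<close> if no \<open>u\<close> is admissible.
\<close>

definition hom_exponent :: "real ^ 'p ^ 'n \<Rightarrow> ereal" where
  "hom_exponent x = Inf {ereal u | u. \<exists>c > 0. \<forall>\<omega> \<in> int_matrices - {0}.
     infnorm (\<omega> ** x) > c * infnorm \<omega> powr (- u)}"

end

theory Submission
  imports Defs
begin

text \<open>
  Regard \<open>\<omega> \<mapsto> (\<omega>, \<omega> x)\<close> on the lattice of integer matrices. If the body
  \<open>K = {Z. \<parallel>Z\<parallel> \<le> b, \<parallel>Z x\<parallel> \<le> a}\<close> contains no nonzero integer matrix, then a pigeonhole count bounds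
  by \<open>O(a\<^bsup>-np\<^esup> b\<^bsup>-n(n-p)\<^esup>)\<close> the number of points that are pairwise \<open>K\<close>-separated modulo the lattice,
  and walking along a segment shows that every real matrix lies within \<open>m K\<close> of the lattice with \<open>m\<close>
  of the same order. With \<open>a = c b\<^bsup>-u\<^esup>\<close>, \<open>u\<close> slightly above \<open>h(x)\<close>, this gives an integer matrix near
  any prescribed real centre \<open>Y\<close>, with the exponents of the theorem. For the sign of the determinant
  one chooses the centre: \<open>Y\<close> approximates the condition \<open>Y x = y\<close> and every matrix close to \<open>Y\<close> (close on
  two scales, one on the span of the columns of \<open>x\<close> and one on a complement) is nonsingular. Since
  \<open>p < n\<close>, a reflection fixing \<open>x\<close> corrects the sign if needed.
\<close>

subsection \<open>Covering modulo the integer lattice\<close>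

text \<open>Stated for any Euclidean space, so that packing and covering are argued with plain
  vectors; on square matrices it is \<open>int_matrices\<close>.\<close>

definition int_points :: "'a::euclidean_space set" where
  "int_points = {z. \<forall>b\<in>Basis. z \<bullet> b \<in> \<int>}"

lemma int_points_0: "0 \<in> int_points"
  by (auto simp: int_points_def)

lemma linear_infnorm_bound:
  fixes f :: "'a::euclidean_space \<Rightarrow> 'b::euclidean_space"
  assumes "linear f"
  obtains C where "C > 0" "\<And>z. infnorm (f z) \<le> C * infnorm z"
proof -
  obtain B where B: "B > 0" "\<And>z. norm (f z) \<le> B * norm z"
    using linear_bounded_pos[OF assms] by blast
  show ?thesis
  proof (rule that)
    show "B * sqrt DIM('a) > 0" using B by simp
    fix z
    have "infnorm (f z) \<le> B * norm z" using infnorm_le_norm B(2) order_trans by blast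
    also have "\<dots> \<le> B * (sqrt DIM('a) * infnorm z)"
      using norm_le_infnorm B(1) by (intro mult_left_mono) auto
    finally show "infnorm (f z) \<le> B * sqrt DIM('a) * infnorm z" by simp
  qed
qed

lemma infnorm_le_iff:
  fixes z :: "'a::euclidean_space"
  shows "infnorm z \<le> r \<longleftrightarrow> (\<forall>b\<in>Basis. \<bar>z \<bullet> b\<bar> \<le> r)"
  unfolding infnorm_Max by simp

text \<open>Pigeonhole: each point of \<open>S\<close>, reduced modulo 1 and shifted by the integer
  vectors of a cube of side about \<open>b\<close>, yields about \<open>b ^ DIM('a)\<close> points.
  Their images under \<open>f\<close> lie in a box of side O(b), cut into cells of side
  \<open>a\<close>. Two of the points in one cell would contradict the separation or the absence of
  nonzero lattice points. The constant depends on \<open>f\<close> alone.\<close>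

lemma separated_mod_int_points_card_le:
  fixes f :: "'a::euclidean_space \<Rightarrow> 'b::euclidean_space"
  assumes f: "linear f" and dim: "DIM('b) \<le> DIM('a)"
  obtains C where "C > 0"
    "\<And>a b S. \<lbrakk>0 < a; a \<le> b; 1 \<le> b; finite S;
       \<And>q. \<lbrakk>q \<in> int_points; infnorm q \<le> b; infnorm (f q) \<le> a\<rbrakk> \<Longrightarrow> q = 0;
       \<And>s t q. \<lbrakk>s \<in> S; t \<in> S; q \<in> int_points; infnorm (s - t - q) \<le> b; infnorm (f (s - t - q)) \<le> a\<rbrakk> \<Longrightarrow> s = t\<rbrakk>
     \<Longrightarrow> real (card S) * a ^ DIM('b) * b ^ (DIM('a) - DIM('b)) \<le> C"
proof -
  obtain A where A: "A > 0" "\<And>z. infnorm (f z) \<le> A * infnorm z"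
    using linear_infnorm_bound[OF f] by blast
  define C where "C = (4 * A + 8) ^ DIM('b) * 2 ^ (DIM('a) - DIM('b))"
  show ?thesis
  proof (rule that[of C])
    show "C > 0" using A by (simp add: C_def)
    fix a b :: real and S :: "'a set"
    assume a: "0 < a" "a \<le> b" and b: "1 \<le> b" and fin: "finite S"
      and pt: "\<And>q. \<lbrakk>q \<in> int_points; infnorm q \<le> b; infnorm (f q) \<le> a\<rbrakk> \<Longrightarrow> q = 0"
      and sep: "\<And>s t q. \<lbrakk>s \<in> S; t \<in> S; q \<in> int_points; infnorm (s - t - q) \<le> b;
         infnorm (f (s - t - q)) \<le> a\<rbrakk> \<Longrightarrow> s = t"
    \<comment> \<open>Coordinates of points in a cube of side \<open>M\<close> differ by less than
      \<open>b\<close>, and \<open>1 \<le> b\<close> gives \<open>b \<le> 2 * M\<close>, so passing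
      between \<open>b\<close> and \<open>M\<close> costs only a constant.\<close>
    define M where "M = nat \<lfloor>b\<rfloor>"
    have M: "real M \<le> b" "b < real M + 1" "1 \<le> M"
      using b unfolding M_def by linarith+
    define G where "G = (\<Pi>\<^sub>E i\<in>(Basis::'a set). {0..<int M})"
    define w where "w = (\<lambda>(s::'a, k). \<Sum>i\<in>Basis. (frac (s \<bullet> i) + real_of_int (k i)) *\<^sub>R i)"
    define cell where "cell = (\<lambda>z. \<lambda>i\<in>(Basis::'b set). \<lfloor>(f z \<bullet> i) / a\<rfloor>)"
    define L where "L = \<lceil>A * M / a\<rceil>"
    have w_inner: "w (s, k) \<bullet> i = frac (s \<bullet> i) + real_of_int (k i)" if "i \<in> Basis" for s k i
      using that by (simp add: w_def)
    have w_range: "0 \<le> w (s,k) \<bullet> i \<and> w (s,k) \<bullet> i < M" if "k \<in> G" "i \<in> Basis" for s k i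
    proof -
      have "0 \<le> k i" "k i \<le> int M - 1" using that by (auto simp: G_def PiE_iff)
      then have "0 \<le> real_of_int (k i)" "real_of_int (k i) \<le> real M - 1" by linarith+
      then show ?thesis using w_inner[OF that(2), of s k] frac_lt_1[of "s \<bullet> i"] frac_ge_0[of "s \<bullet> i"] by linarith
    qed
    have inj: "inj_on (cell \<circ> w) (S \<times> G)"
    proof (rule inj_onI, clarsimp)
      fix s k t l assume st: "s \<in> S" "k \<in> G" "t \<in> S" "l \<in> G" and eq: "cell (w (s,k)) = cell (w (t,l))"
      \<comment> \<open>The lattice vector by which the difference of the two shifted points
        deviates from \<open>s - t\<close>.\<close>
      define q where "q = (\<Sum>i\<in>Basis. (real_of_int (\<lfloor>s \<bullet> i\<rfloor> - \<lfloor>t \<bullet> i\<rfloor> - k i + l i)) *\<^sub>R i)"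
      have q: "q \<bullet> i = real_of_int (\<lfloor>s \<bullet> i\<rfloor> - \<lfloor>t \<bullet> i\<rfloor> - k i + l i)" if "i \<in> Basis" for i
        using that unfolding q_def by (simp del: of_int_diff of_int_add)
      then have qI: "q \<in> int_points" by (auto simp: int_points_def)
      have d: "w (s,k) - w (t,l) = s - t - q"
        by (rule euclidean_eqI) (simp add: inner_diff_left w_inner q frac_def)
      have d1: "infnorm (s - t - q) \<le> b"
        unfolding d[symmetric] infnorm_le_iff
      proof
        fix i :: 'a assume "i \<in> Basis"
        then show "\<bar>(w (s, k) - w (t, l)) \<bullet> i\<bar> \<le> b"
          using w_range[OF st(2), of i s] w_range[OF st(4), of i t] M unfolding inner_diff_left by linarith
      qed
      have d2: "infnorm (f (s - t - q)) \<le> a"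
        unfolding d[symmetric] infnorm_le_iff
      proof
        fix i :: 'b assume i: "i \<in> Basis"
        have "\<lfloor>(f (w (s,k)) \<bullet> i) / a\<rfloor> = \<lfloor>(f (w (t,l)) \<bullet> i) / a\<rfloor>"
          using fun_cong[OF eq, of i] i by (simp add: cell_def)
        then have "\<bar>(f (w (s,k)) \<bullet> i) / a - (f (w (t,l)) \<bullet> i) / a\<bar> \<le> 1" by linarith
        then show "\<bar>f (w (s, k) - w (t, l)) \<bullet> i\<bar> \<le> a"
          using a by (simp add: linear_diff[OF f] inner_diff_left diff_divide_distrib[symmetric] abs_divide)
      qed
      have "s = t" by (rule sep[OF st(1,3) qI d1 d2])
      \<comment> \<open>For \<open>s = t\<close> the difference is \<open>- q\<close>, a lattice
        point inside the excluded body.\<close>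
      then have "q = 0"
        using pt[of "q"] qI d1 d2 by (simp add: infnorm_neg linear_neg[OF f])
      then have "k i = l i" if "i \<in> Basis" for i
        using q[OF that] \<open>s = t\<close> by simp
      then have "k = l" using st(2,4) unfolding G_def by (intro PiE_ext) auto
      then show "s = t \<and> k = l" using \<open>s = t\<close> by simp
    qed
    define H where "H = (\<Pi>\<^sub>E i\<in>(Basis::'b set). {-L-1..L})"
    have sub: "(cell \<circ> w) ` (S \<times> G) \<subseteq> H"
    proof (clarsimp)
      fix s k assume "s \<in> S" "k \<in> G"
      have *: "infnorm (w (s,k)) \<le> M"
        unfolding infnorm_le_iff
        using w_range[OF \<open>k \<in> G\<close>, of _ s] by (simp add: less_imp_le)
      have "\<lfloor>(f (w (s,k)) \<bullet> i) / a\<rfloor> \<in> {-L-1..L}" if "i \<in> Basis" for i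
      proof -
        have "\<bar>f (w (s,k)) \<bullet> i\<bar> \<le> A * M"
          using Basis_le_infnorm[OF that, of "f (w (s,k))"] A(2)[of "w (s,k)"] mult_left_mono[OF *, of A] A(1)
          by linarith
        then have "\<bar>(f (w (s,k)) \<bullet> i) / a\<bar> \<le> A * M / a" using a by (simp add: abs_divide divide_right_mono)
        then show ?thesis unfolding L_def by (simp; linarith)
      qed
      then show "cell (w (s,k)) \<in> H" unfolding H_def cell_def by auto
    qed
    have "finite H" unfolding H_def by (intro finite_PiE) auto
    then have "card (S \<times> G) \<le> card H"
      using card_inj_on_le[OF inj sub] by simp
    then have "card S * M ^ DIM('a) \<le> (nat (2 * L + 2)) ^ DIM('b)"
      by (simp add: card_cartesian_product G_def H_def card_PiE algebra_simps)
    then have "real (card S * M ^ DIM('a)) \<le> real ((nat (2 * L + 2)) ^ DIM('b))"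
      by (rule of_nat_mono)
    then have 1: "real (card S) * real M ^ DIM('a) \<le> real (nat (2 * L + 2)) ^ DIM('b)"
      by simp
    have "real (nat (2 * L + 2)) \<le> (4 * A + 8) * M / a"
    proof -
      have "0 \<le> A * M / a" using A a by simp
      \<comment> \<open>From \<open>a \<le> b \<le> 2 * M\<close>: it absorbs the additive 4 due to
        rounding into a multiple of \<open>M / a\<close>.\<close>
      moreover have "1 \<le> 2 * real M / a" using a M by (simp add: field_simps)
      moreover have "real_of_int L \<le> A * M / a + 1" "0 \<le> L" using \<open>0 \<le> A * M / a\<close> unfolding L_def by linarith+
      ultimately have "real (nat (2 * L + 2)) \<le> 2 * (A * M / a) + 4"
        by simp
      also have "\<dots> \<le> 4 * (A * M / a) + 4 * (2 * real M / a)"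
        using \<open>0 \<le> A * M / a\<close> \<open>1 \<le> 2 * real M / a\<close> by linarith
      also have "\<dots> = (4 * A + 8) * M / a" by (simp add: field_simps add_divide_distrib)
      finally show ?thesis .
    qed
    then have "real (nat (2 * L + 2)) ^ DIM('b) \<le> ((4 * A + 8) * M / a) ^ DIM('b)"
      by (intro power_mono) auto
    with 1 have "real (card S) * real M ^ DIM('a) \<le> ((4 * A + 8) * M / a) ^ DIM('b)" by linarith
    then have "real (card S) * real M ^ (DIM('a) - DIM('b)) * real M ^ DIM('b)
        \<le> (4 * A + 8) ^ DIM('b) / a ^ DIM('b) * real M ^ DIM('b)"
      using dim by (simp add: power_mult_distrib power_divide mult.assoc flip: power_add)
    then have "real (card S) * real M ^ (DIM('a) - DIM('b)) \<le> (4 * A + 8) ^ DIM('b) / a ^ DIM('b)"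
      using M(3) by (subst (asm) mult_le_cancel_right_pos) simp_all
    then have 2: "real (card S) * a ^ DIM('b) * real M ^ (DIM('a) - DIM('b)) \<le> (4 * A + 8) ^ DIM('b)"
      using a by (simp add: field_simps)
    have "b \<le> 2 * real M" using M by linarith
    then have "b ^ (DIM('a) - DIM('b)) \<le> (2 * real M) ^ (DIM('a) - DIM('b))"
      using b by (intro power_mono) auto
    then have "real (card S) * a ^ DIM('b) * b ^ (DIM('a) - DIM('b))
        \<le> real (card S) * a ^ DIM('b) * (2 * real M) ^ (DIM('a) - DIM('b))"
      using a by (intro mult_left_mono) auto
    also have "\<dots> = (real (card S) * a ^ DIM('b) * real M ^ (DIM('a) - DIM('b))) * 2 ^ (DIM('a) - DIM('b))"
      by (simp add: power_mult_distrib)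
    also have "\<dots> \<le> C" unfolding C_def using 2 by (intro mult_right_mono) auto
    finally show "real (card S) * a ^ DIM('b) * b ^ (DIM('a) - DIM('b)) \<le> C" .
  qed
qed

text \<open>The distance of \<open>z\<close> to the lattice, measured in multiples of the body, is
  bounded by counting the levels met on the segment from 0 to \<open>z\<close>. The product of
  powers is, for surjective \<open>f\<close>, the volume of the body up to a constant. The separate
  upper bound for it later forces the exponent \<open>e\<close> to be nonnegative.\<close>

lemma int_points_covering:
  fixes f :: "'a::euclidean_space \<Rightarrow> 'b::euclidean_space"
  assumes f: "linear f" and dim: "DIM('b) \<le> DIM('a)"
  obtains C where "C > 0"
    "\<And>a b z. \<lbrakk>0 < a; a \<le> b; 1 \<le> b;
       \<And>q. \<lbrakk>q \<in> int_points; infnorm q \<le> b; infnorm (f q) \<le> a\<rbrakk> \<Longrightarrow> q = 0\<rbrakk>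
     \<Longrightarrow> a ^ DIM('b) * b ^ (DIM('a) - DIM('b)) \<le> C \<and>
       (\<exists>q\<in>int_points. infnorm (z - q) * (a ^ DIM('b) * b ^ (DIM('a) - DIM('b))) \<le> C * b \<and>
          infnorm (f (z - q)) * (a ^ DIM('b) * b ^ (DIM('a) - DIM('b))) \<le> C * a)"
proof -
  obtain C where "C > 0" and C:
    "\<And>a b S. \<lbrakk>0 < a; a \<le> b; 1 \<le> b; finite S;
       \<And>q. \<lbrakk>q \<in> int_points; infnorm q \<le> b; infnorm (f q) \<le> a\<rbrakk> \<Longrightarrow> q = 0;
       \<And>s t q. \<lbrakk>s \<in> S; t \<in> S; q \<in> int_points; infnorm (s - t - q) \<le> b; infnorm (f (s - t - q)) \<le> a\<rbrakk> \<Longrightarrow> s = t\<rbrakk>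
     \<Longrightarrow> real (card S) * a ^ DIM('b) * b ^ (DIM('a) - DIM('b)) \<le> C"
    using separated_mod_int_points_card_le[OF f dim] by blast
  show ?thesis
  proof (rule that[of "2 * C"])
    show "2 * C > 0" using \<open>C > 0\<close> by simp
    fix a b :: real and z :: 'a
    assume a: "0 < a" "a \<le> b" and b: "1 \<le> b"
      and pt: "\<And>q. \<lbrakk>q \<in> int_points; infnorm q \<le> b; infnorm (f q) \<le> a\<rbrakk> \<Longrightarrow> q = 0"
    define V where "V = a ^ DIM('b) * b ^ (DIM('a) - DIM('b))"
    have V: "V > 0" using a b by (simp add: V_def)
    have card_le: "real (card S) * V \<le> C" if "finite S"
      "\<And>s t q. \<lbrakk>s \<in> S; t \<in> S; q \<in> int_points; infnorm (s - t - q) \<le> b; infnorm (f (s - t - q)) \<le> a\<rbrakk> \<Longrightarrow> s = t"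
      for S
      using C[OF a b that(1) pt that(2)] unfolding V_def by (simp add: mult.assoc)
    \<comment> \<open>A single point is trivially separated.\<close>
    have V_le: "V \<le> 2 * C"
      using card_le[of "{0}"] \<open>C > 0\<close> by simp
    define near where "near = (\<lambda>(m::nat) w. \<exists>q\<in>int_points. infnorm (w - q) \<le> m * b \<and> infnorm (f (w - q)) \<le> m * a)"
    define d where "d = (\<lambda>w. LEAST m. near m w)"
    have bound_ex: "\<exists>N\<ge>1. infnorm w \<le> real N * b \<and> infnorm (f w) \<le> real N * a" for w
    proof -
      obtain N where N: "max 1 (max (infnorm w / b) (infnorm (f w) / a)) \<le> real N"
        using real_arch_simple by blast
      then have "infnorm w \<le> real N * b" "infnorm (f w) \<le> real N * a" "N \<ge> 1"
        using a b by (simp_all add: field_simps)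
      then show ?thesis by blast
    qed
    have near_d: "near (d w) w" for w
    proof -
      have "\<exists>m. near m w"
        using bound_ex[of w] int_points_0 unfolding near_def by (metis diff_zero)
      then show ?thesis unfolding d_def by (rule LeastI_ex)
    qed
    have d_step: "d s \<le> d t + 1"
      if q: "q \<in> int_points" "infnorm (s - t - q) \<le> b" "infnorm (f (s - t - q)) \<le> a" for s t q
    proof -
      obtain r where r: "r \<in> int_points" "infnorm (t - r) \<le> d t * b" "infnorm (f (t - r)) \<le> d t * a"
        using near_d[of t] unfolding near_def by blast
      have eq: "s - (q + r) = (s - t - q) + (t - r)" by simp
      have "near (d t + 1) s" unfolding near_def
      proof (intro bexI conjI)
        show "q + r \<in> int_points" using q(1) r(1) by (auto simp: int_points_def inner_add_left)
        show "infnorm (s - (q + r)) \<le> real (d t + 1) * b"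
          unfolding eq using infnorm_triangle[of "s - t - q" "t - r"] q r by (simp add: algebra_simps)
        show "infnorm (f (s - (q + r))) \<le> real (d t + 1) * a"
          unfolding eq linear_add[OF f] using infnorm_triangle[of "f (s - t - q)" "f (t - r)"] q r
          by (simp add: algebra_simps)
      qed
      then show ?thesis unfolding d_def by (rule Least_le)
    qed
    \<comment> \<open>With \<open>N\<close> equal steps from 0 to \<open>z\<close>, each step lies
      in the body.\<close>
    obtain N where N: "N \<ge> 1" "infnorm z \<le> real N * b" "infnorm (f z) \<le> real N * a"
      using bound_ex[of z] by blast
    define W where "W = (\<lambda>j::nat. (real j / real N) *\<^sub>R z)"
    have d0: "d (W 0) = 0"
    proof -
      have "near 0 (W 0)" unfolding near_def W_def
        using int_points_0 by (auto simp: infnorm_0 linear_0[OF f] intro!: bexI[of _ 0])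
      then show ?thesis unfolding d_def by (simp add: Least_le[THEN le_zero_eq[THEN iffD1]])
    qed
    have dSuc: "d (W (Suc j)) \<le> d (W j) + 1" for j
    proof (rule d_step[OF int_points_0])
      have *: "W (Suc j) - W j - 0 = (1 / real N) *\<^sub>R z"
        by (simp add: W_def add_divide_distrib flip: scaleR_diff_left)
      show "infnorm (W (Suc j) - W j - 0) \<le> b" "infnorm (f (W (Suc j) - W j - 0)) \<le> a"
        unfolding * linear_cmul[OF f] infnorm_mul using N by (simp_all add: field_simps)
    qed
    \<comment> \<open>\<open>d\<close> grows by at most \<open>1\<close> per step, so it attains every even value up to \<open>d z\<close>; points at distinct
      even levels are separated, and the packing bound therefore controls \<open>d z\<close>.\<close>
    have levels: "\<exists>j. d (W j) = k" if "k \<le> d (W n)" for k n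
      using that
    proof (induction n)
      case 0
      then show ?case using d0 by auto
    next
      case (Suc n)
      show ?case
      proof (cases "k = d (W (Suc n))")
        case False
        then have "k \<le> d (W n)" using Suc.prems dSuc[of n] by linarith
        then show ?thesis by (rule Suc.IH)
      qed blast
    qed
    have WN: "W N = z" using N(1) by (simp add: W_def)
    define m where "m = d z"
    have "\<forall>k\<in>{..m div 2}. \<exists>j. d (W j) = 2 * k"
    proof
      fix k assume "k \<in> {..m div 2}"
      then have "2 * k \<le> d (W N)" unfolding WN m_def[symmetric] by simp
      then show "\<exists>j. d (W j) = 2 * k" by (rule levels)
    qed
    then obtain j where j: "\<And>k. k \<le> m div 2 \<Longrightarrow> d (W (j k)) = 2 * k"
      using bchoice[of "{..m div 2}" "\<lambda>k j. d (W j) = 2 * k"] by auto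
    define S where "S = (\<lambda>k. W (j k)) ` {..m div 2}"
    have "card S = m div 2 + 1"
      unfolding S_def
    proof (subst card_image)
      show "inj_on (\<lambda>k. W (j k)) {..m div 2}"
        by (rule inj_onI) (metis atMost_iff j mult_cancel1 zero_neq_numeral)
    qed simp
    moreover have "real (card S) * V \<le> C"
    proof (rule card_le)
      show "finite S" by (simp add: S_def)
      fix s t q assume st: "s \<in> S" "t \<in> S"
        and q: "q \<in> int_points" "infnorm (s - t - q) \<le> b" "infnorm (f (s - t - q)) \<le> a"
      obtain k l where kl: "k \<le> m div 2" "s = W (j k)" "l \<le> m div 2" "t = W (j l)"
        using st by (auto simp: S_def)
      have "d s \<le> d t + 1" by (rule d_step[OF q])
      moreover have "d t \<le> d s + 1"
      proof (rule d_step[of "- q"])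
        have *: "t - s - (- q) = - (s - t - q)" by simp
        show "- q \<in> int_points" using q(1) by (auto simp: int_points_def)
        show "infnorm (t - s - (- q)) \<le> b" "infnorm (f (t - s - (- q))) \<le> a"
          unfolding * linear_neg[OF f] infnorm_neg using q by auto
      qed
      ultimately have "k = l" using j kl by fastforce
      then show "s = t" using kl by simp
    qed
    ultimately have "real (m div 2 + 1) * V \<le> C" by simp
    \<comment> \<open>Only every second level was counted, whence the factor 2 in the
      constant.\<close>
    moreover have "m \<le> 2 * (m div 2 + 1)" by presburger
    then have "real m \<le> 2 * real (m div 2 + 1)" by linarith
    then have "real m * V \<le> 2 * real (m div 2 + 1) * V" using V by (intro mult_right_mono) auto
    ultimately have mV: "real m * V \<le> 2 * C" by linarith
    obtain q where q: "q \<in> int_points" "infnorm (z - q) \<le> m * b" "infnorm (f (z - q)) \<le> m * a"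
      using near_d[of z] unfolding near_def m_def by blast
    have scale: "r * V \<le> 2 * C * t" if "r \<le> m * t" "0 \<le> t" for r t :: real
    proof -
      have "r * V \<le> (m * t) * V" using that(1) V by (intro mult_right_mono) auto
      also have "\<dots> = (m * V) * t" by simp
      also have "\<dots> \<le> 2 * C * t" by (rule mult_right_mono[OF mV that(2)])
      finally show ?thesis .
    qed
    have "infnorm (z - q) * V \<le> 2 * C * b" using scale[OF q(2)] b by simp
    moreover have "infnorm (f (z - q)) * V \<le> 2 * C * a" using scale[OF q(3)] a by simp
    ultimately show "a ^ DIM('b) * b ^ (DIM('a) - DIM('b)) \<le> 2 * C \<and>
       (\<exists>q\<in>int_points. infnorm (z - q) * (a ^ DIM('b) * b ^ (DIM('a) - DIM('b))) \<le> 2 * C * b \<and>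
          infnorm (f (z - q)) * (a ^ DIM('b) * b ^ (DIM('a) - DIM('b))) \<le> 2 * C * a)"
      using V_le q(1) unfolding V_def by blast
  qed
qed

subsection \<open>Centres whose neighbourhoods have positive determinant\<close>

text \<open>\<open>g\<close> maps \<open>ker f\<close> isometrically into the orthogonal complement of the range of \<open>f\<close>.\<close>

lemma exists_bounded_below_completion:
  fixes f :: "'a::euclidean_space \<Rightarrow> 'a"
  assumes f: "linear f"
  obtains g c where "linear g" "c > 0"
    "\<And>\<eta> v. 0 < \<eta> \<Longrightarrow> \<eta> \<le> 1 \<Longrightarrow> c * \<eta> * norm v \<le> norm (f v + \<eta> *\<^sub>R g v)"
proof -
  define S where "S = {v. f v = 0}"
  define S' where "S' = {y \<in> UNIV. \<forall>x\<in>S. orthogonal x y}"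
  define T where "T = {y \<in> UNIV. \<forall>x\<in>range f. orthogonal x y}"
  have S: "subspace S"
    unfolding S_def by (rule linear_subspace_kernel[OF f])
  have S': "subspace S'"
    unfolding S'_def by (auto simp: subspace_def orthogonal_clauses)
  have T: "subspace T"
    unfolding T_def by (auto simp: subspace_def orthogonal_clauses)
  have R: "subspace (range f)"
    by (simp add: f linear_subspace_image)
  have decomp: "\<exists>a b. a \<in> S \<and> b \<in> S' \<and> v = a + b" for v
  proof -
    obtain a b where "a \<in> span S" "\<And>w. w \<in> span S \<Longrightarrow> orthogonal b w" "v = a + b"
      using orthogonal_subspace_decomp_exists[of S v] by blast
    moreover have "span S = S" using S by (simp add: span_eq_iff)
    ultimately show ?thesis unfolding S'_def by (auto simp: orthogonal_commute)
  qed
  have inj': "\<forall>x\<in>S'. f x = 0 \<longrightarrow> x = 0"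
    unfolding S'_def S_def using orthogonal_self by blast
  have "range f = f ` S'"
  proof -
    have "f v \<in> f ` S'" for v
    proof -
      obtain a b where "a \<in> S" "b \<in> S'" "v = a + b" using decomp by blast
      then have "f v = f b" using f by (simp add: S_def linear_add)
      then show ?thesis using \<open>b \<in> S'\<close> by blast
    qed
    then show ?thesis by blast
  qed
  moreover have "dim (f ` S') = dim S'"
  proof (rule dim_image_eq[OF f])
    show "inj_on f (span S')"
      using linear_injective_on_subspace_0[OF f S'] inj' S' by (simp add: span_eq_iff[THEN iffD2])
  qed
  moreover have "dim S' + dim S = DIM('a)"
    unfolding S'_def using dim_subspace_orthogonal_to_vectors[OF S subspace_UNIV] by simp
  moreover have "dim T + dim (range f) = DIM('a)"
    unfolding T_def using dim_subspace_orthogonal_to_vectors[OF R subspace_UNIV] by simp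
  \<comment> \<open>By rank-nullity the kernel and the complement of the range have equal dimension,
    which leaves room for an isometric embedding.\<close>
  ultimately have "dim S \<le> dim T" by (metis add.commute add_left_imp_eq order_refl)
  then obtain h where h: "linear h" "h \<in> S \<rightarrow> T" "\<And>x. x \<in> S \<Longrightarrow> norm (h x) = norm x"
    using isometry_subset_subspace[OF S T] by metis
  obtain B where B: "B \<subseteq> S" "independent B" "S \<subseteq> span B" "card B = dim S"
    by (rule basis_exists[of S])
  have spanB: "span B = S" using B S by (metis span_subspace)
  \<comment> \<open>The clause on the range puts every value of \<open>g\<close>, not only those on
    the kernel, orthogonal to the range of \<open>f\<close>, so that Pythagoras applies to all
    \<open>v\<close>.\<close>
  obtain g where g: "linear g" "\<forall>x\<in>B. g x = h x" "range g = span (h ` B)"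
    using linear_independent_extend_subspace[OF B(2)] by blast
  have gh: "g x = h x" if "x \<in> S" for x
    using linear_eq_on_span[OF g(1) h(1), of B] g(2) that spanB by auto
  have gT: "g x \<in> T" for x
  proof -
    have "span (h ` B) \<subseteq> T"
      using B(1) h(2) T by (intro span_minimal) auto
    then show ?thesis using g(3) by blast
  qed
  obtain e where e: "e > 0" "\<And>x. x \<in> S' \<Longrightarrow> e * norm x \<le> norm (f x)"
    using injective_imp_isometric[OF closed_subspace[OF S'] S' f[unfolded linear_conv_bounded_linear] inj'] by blast
  obtain M where M: "M > 0" "\<And>x. norm (g x) \<le> M * norm x"
    using linear_bounded_pos[OF g(1)] by blast
  define D where "D = 1 + (M + 1) / e"
  have D: "D > 0" using e M by (simp add: D_def add_pos_pos)
  show ?thesis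
  proof (rule that[OF g(1)])
    show "1 / D > 0" using D by simp
    fix \<eta> :: real and v assume \<eta>: "0 < \<eta>" "\<eta> \<le> 1"
    define w where "w = f v + \<eta> *\<^sub>R g v"
    have orth: "orthogonal (f v) (\<eta> *\<^sub>R g v)"
      using gT[of v] unfolding T_def by (auto simp: orthogonal_clauses)
    have sq: "(norm w)\<^sup>2 = (norm (f v))\<^sup>2 + (norm (\<eta> *\<^sub>R g v))\<^sup>2"
      unfolding w_def by (rule norm_add_Pythagorean[OF orth])
    have w1: "norm (f v) \<le> norm w"
      by (rule power2_le_imp_le) (use sq in auto)
    have w2: "\<eta> * norm (g v) \<le> norm w"
    proof (rule power2_le_imp_le)
      show "(\<eta> * norm (g v))\<^sup>2 \<le> (norm w)\<^sup>2" using sq \<eta> by (simp add: power_mult_distrib)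
    qed simp
    obtain a b where ab: "a \<in> S" "b \<in> S'" "v = a + b" using decomp by blast
    have "f v = f b" using f ab by (simp add: S_def linear_add)
    then have "e * norm b \<le> norm w" using e(2)[OF ab(2)] w1 by simp
    then have b: "norm b \<le> norm w / e" using e(1) by (simp add: field_simps)
    \<comment> \<open>The kernel component \<open>a\<close> is invisible to \<open>f\<close> and is
      recovered through \<open>g\<close> at the cost of \<open>1 / \<eta>\<close>; \<open>f\<close>
      controls the component \<open>b\<close> without that loss.\<close>
    have "norm a = norm (g a)" using h(3) gh ab(1) by simp
    also have "g a = g v - g b" using g(1) ab by (simp add: linear_add)
    also have "norm \<dots> \<le> norm (g v) + M * norm b"
      using norm_triangle_ineq4[of "g v" "g b"] M(2)[of b] by linarith
    also have "\<dots> \<le> norm w / \<eta> + M * (norm w / e)"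
      using w2 b \<eta> M by (intro add_mono mult_left_mono) (auto simp: field_simps)
    finally have "norm v \<le> norm w / \<eta> + M * (norm w / e) + norm w / e"
      using b norm_triangle_ineq[of a b] unfolding ab(3) by linarith
    also have "\<dots> = norm w / \<eta> + norm w * (M + 1) / e"
      by (simp add: field_simps add_divide_distrib)
    also have "\<dots> \<le> norm w / \<eta> + (norm w * (M + 1) / e) / \<eta>"
    proof -
      have "0 \<le> norm w * (M + 1) / e" using M e by simp
      from divide_left_mono[OF \<eta>(2) this] \<eta> show ?thesis by simp
    qed
    also have "\<dots> = D * norm w / \<eta>" by (simp add: D_def field_simps add_divide_distrib)
    finally show "1 / D * \<eta> * norm v \<le> norm (f v + \<eta> *\<^sub>R g v)"
      using \<eta> D unfolding w_def by (simp add: field_simps)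
  qed
qed

text \<open>An orthogonal map takes the direction of \<open>v\<close> to a coordinate axis; change
  the sign of that coordinate and go back.\<close>

lemma exists_reflection_matrix:
  fixes v :: "real ^ 'n"
  assumes "v \<noteq> 0"
  obtains \<rho> :: "real ^ 'n ^ 'n" where "det \<rho> = -1" "\<And>z. orthogonal v z \<Longrightarrow> \<rho> *v z = z"
proof -
  define u where "u = v /\<^sub>R norm v"
  have u: "norm u = 1" using assms by (simp add: u_def)
  obtain k :: 'n where True by simp
  obtain f where f: "orthogonal_transformation f" "f u = axis k (1::real)"
    using orthogonal_transformation_exists_1[of u "axis k 1"] u by auto
  define D :: "real ^ 'n ^ 'n" where "D = (\<chi> i j. if i = j then (if i = k then -1 else 1) else 0)"
  define R where "R = matrix f"
  have Rf: "R *v z = f z" for z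
    unfolding R_def using f(1) by (simp add: matrix_works orthogonal_transformation_linear)
  have oR: "orthogonal_matrix R"
    using f(1) by (simp add: R_def orthogonal_transformation_matrix)
  have "det D = (\<Prod>i\<in>UNIV. if i = k then -1 else 1)"
    by (subst det_diagonal) (auto simp: D_def)
  then have detD: "det D = -1" by simp
  show ?thesis
  proof (rule that)
    have "det (transpose R ** D ** R) = det R * det R * det D"
      by (simp add: det_mul)
    then show "det (transpose R ** D ** R) = -1"
      using det_orthogonal_matrix[OF oR] detD by auto
    fix z assume "orthogonal v z"
    then have "u \<bullet> z = 0" by (simp add: u_def orthogonal_def)
    then have "axis k 1 \<bullet> f z = 0"
      using f by (metis orthogonal_transformation_def)
    then have "f z $ k = 0" by (simp add: inner_axis')
    then have "D *v (f z) = f z"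
      by (auto simp: D_def matrix_vector_mult_def vec_eq_iff if_distrib[of "\<lambda>t. t * _"] cong: if_cong)
    then have "(transpose R ** D ** R) *v z = transpose R *v (R *v z)"
      by (simp add: Rf matrix_vector_mul_assoc[symmetric])
    also have "\<dots> = z"
      using oR by (simp add: orthogonal_matrix_def matrix_vector_mul_assoc)
    finally show "(transpose R ** D ** R) *v z = z" .
  qed
qed

section \<open>Nonsingularity under perturbations on two scales\<close>

lemma matrix_vector_mult_infnorm_bound:
  obtains C where "C > 0" "\<And>(A :: real ^ 'm ^ 'n) v. norm (A *v v) \<le> C * infnorm A * norm v"
proof -
  have "bilinear ((*v) :: real ^ 'm ^ 'n \<Rightarrow> _)"
    by (auto simp: bilinear_def linear_iff matrix_vector_mult_add_rdistrib matrix_vector_right_distrib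
        matrix_vector_mult_scaleR scaleR_matrix_vector_assoc)
  then obtain B where B: "B > 0" "\<And>(A :: real ^ 'm ^ 'n) v. norm (A *v v) \<le> B * norm A * norm v"
    using bilinear_bounded_pos by blast
  show ?thesis
  proof (rule that)
    show "B * sqrt DIM(real ^ 'm ^ 'n) > 0" using B by simp
    fix A :: "real ^ 'm ^ 'n" and v
    have "norm (A *v v) \<le> B * norm A * norm v" by (rule B)
    also have "\<dots> \<le> B * (sqrt DIM(real ^ 'm ^ 'n) * infnorm A) * norm v"
      using norm_le_infnorm[of A] B(1) by (intro mult_left_mono mult_right_mono) auto
    finally show "norm (A *v v) \<le> B * sqrt DIM(real ^ 'm ^ 'n) * infnorm A * norm v"
      by (simp add: mult.assoc)
  qed
qed

lemma lin_indep_columns_left_inverse: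
  fixes x :: "real ^ 'p ^ 'n"
  assumes "lin_indep_columns x"
  obtains x' where "x' ** x = mat 1"
proof -
  have "columns x = range (\<lambda>j. column j x)" by (auto simp: columns_def)
  then have "rank x = CARD('p)"
    using assms by (simp add: column_rank_def lin_indep_columns_def dim_eq_card_independent card_image)
  then have "inj ((*v) x)" by (simp add: full_rank_injective)
  then obtain x' where "x' ** x = mat 1" using matrix_left_invertible_injective[of x] by blast
  then show ?thesis by (rule that)
qed

lemma linear_matrix_mult_right: "linear (\<lambda>A :: real ^ 'm ^ 'n. A ** B)"
proof (rule linearI)
  show "(A1 + A2) ** B = A1 ** B + A2 ** B" for A1 A2 :: "real ^ 'm ^ 'n"
    by (vector matrix_matrix_mult_def sum.distrib[symmetric] field_simps)
qed (simp add: scalar_matrix_assoc)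

text \<open>The covering yields errors \<open>E\<close> that may be large although
  \<open>E ** x\<close> is small, hence two tolerances. If \<open>y\<close> has dependent columns,
  every exact solution of \<open>Y ** x = y\<close> is singular, so exactness is given up by
  O(\<eta>). A kernel vector \<open>v\<close> of \<open>Y + E\<close> is excluded by comparing a
  lower bound for \<open>Y *v v\<close> with an upper bound for \<open>E *v v\<close>, both in terms
  of a rescaled vector \<open>w\<close>.\<close>

lemma exists_robust_invertible:
  fixes x y :: "real ^ 'p ^ 'n"
  assumes "lin_indep_columns x"
  obtains K where "K > 0"
    "\<And>\<eta> \<tau>. \<lbrakk>0 < \<eta>; \<eta> \<le> 1; 0 < \<tau>\<rbrakk> \<Longrightarrow> \<exists>Y. infnorm (Y ** x - y) \<le> K * \<eta> \<and> infnorm Y \<le> K * (1 + \<tau>) \<and>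
       (\<forall>E. infnorm (E ** x) * K \<le> \<eta> \<longrightarrow> infnorm E * K \<le> \<tau> \<longrightarrow> det (Y + E) \<noteq> 0)"
proof -
  obtain x' where x': "x' ** x = mat 1" using lin_indep_columns_left_inverse[OF assms] by blast
  have x'x: "x' *v (x *v t) = t" for t by (simp add: matrix_vector_mul_assoc x')
  \<comment> \<open>\<open>B\<close> solves \<open>B ** x = y\<close>, and \<open>P\<close> projects
    onto the column span of \<open>x\<close> along the kernel of \<open>x'\<close>.\<close>
  define B where "B = y ** x'"
  define P where "P = x ** x'"
  have P: "P *v v = x *v (x' *v v)" for v by (simp add: P_def matrix_vector_mul_assoc)
  have B: "B *v v = y *v (x' *v v)" for v by (simp add: B_def matrix_vector_mul_assoc)
  obtain g c where g: "linear g" and c: "c > 0"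
    and gc: "\<And>\<eta> v. 0 < \<eta> \<Longrightarrow> \<eta> \<le> 1 \<Longrightarrow> c * \<eta> * norm v \<le> norm (B *v v + \<eta> *\<^sub>R g v)"
    using exists_bounded_below_completion[of "(*v) B"] by auto
  define G where "G = matrix g"
  have G: "G *v v = g v" for v using g by (simp add: G_def matrix_works)
  obtain N1 where N1: "N1 > 0" "\<And>(A :: real ^ 'p ^ 'n) v. norm (A *v v) \<le> N1 * infnorm A * norm v"
    using matrix_vector_mult_infnorm_bound by blast
  obtain N2 where N2: "N2 > 0" "\<And>(A :: real ^ 'n ^ 'n) v. norm (A *v v) \<le> N2 * infnorm A * norm v"
    using matrix_vector_mult_infnorm_bound by blast
  obtain M1 where M1: "M1 > 0" "\<And>v. norm (x' *v v) \<le> M1 * norm v"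
    using linear_bounded_pos[of "(*v) x'"] by auto
  obtain M2 where M2: "M2 > 0" "\<And>v. norm (v - P *v v) \<le> M2 * norm v"
    using linear_bounded_pos[OF linear_compose_sub[OF linear_ident matrix_vector_mul_linear[of P]]] by blast
  \<comment> \<open>The last summand makes \<open>c * K\<close> exceed
    \<open>N1 * M1 + N2 * M2\<close>, so that \<open>E\<close> loses against \<open>Y\<close> in the
    final comparison; the other norms bound \<open>Y\<close> and \<open>Y ** x - y\<close>.\<close>
  define K where "K = 1 + infnorm (G ** x) + infnorm B + infnorm (G ** P) + infnorm (G - G ** P)
    + (N1 * M1 + N2 * M2) / c"
  have pos: "0 \<le> (N1 * M1 + N2 * M2) / c"
    using N1(1) M1(1) N2(1) M2(1) c by simp
  have K0: "(N1 * M1 + N2 * M2) / c < K" "infnorm (G ** x) \<le> K"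
    "infnorm B + infnorm (G ** P) + infnorm (G - G ** P) \<le> K" "0 < K"
    unfolding K_def using infnorm_pos_le[of "G ** x"] infnorm_pos_le[of B] infnorm_pos_le[of "G ** P"]
      infnorm_pos_le[of "G - G ** P"] pos
    by linarith+
  have Kc: "N1 * M1 + N2 * M2 < c * K" using K0(1) c by (simp add: field_simps)
  show ?thesis
  proof (rule that[OF \<open>0 < K\<close>])
    fix \<eta> \<tau> :: real assume \<eta>: "0 < \<eta>" "\<eta> \<le> 1" and \<tau>: "0 < \<tau>"
    \<comment> \<open>\<open>Y\<close> is the composition of \<open>B + \<eta> g\<close> with the map that is the identity on the column span of \<open>x\<close>
      and \<open>\<tau> / \<eta>\<close> on \<open>ker x'\<close>.\<close>
    define Y where "Y = B + \<eta> *\<^sub>R (G ** P) + \<tau> *\<^sub>R (G - G ** P)"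
    have Yv: "Y *v v = B *v v + \<eta> *\<^sub>R g (P *v v) + \<tau> *\<^sub>R g (v - P *v v)" for v
      unfolding Y_def
      by (simp add: matrix_vector_mult_add_rdistrib matrix_vector_mult_diff_rdistrib
          G linear_diff[OF g] flip: scaleR_matrix_vector_assoc matrix_vector_mul_assoc)
    have "Y ** x - y = \<eta> *\<^sub>R (G ** x)"
    proof -
      have "(Y ** x) *v t = (y + \<eta> *\<^sub>R (G ** x)) *v t" for t
        by (simp add: matrix_vector_mult_add_rdistrib Yv P B x'x G linear_0[OF g]
          flip: scaleR_matrix_vector_assoc matrix_vector_mul_assoc)
      then have "Y ** x = y + \<eta> *\<^sub>R (G ** x)" by (simp add: matrix_eq)
      then show ?thesis by simp
    qed
    then have "infnorm (Y ** x - y) = \<eta> * infnorm (G ** x)"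
      using \<eta> by (simp add: infnorm_mul)
    also have "\<dots> \<le> \<eta> * K" using K0 \<eta> by (intro mult_left_mono) auto
    finally have Y1: "infnorm (Y ** x - y) \<le> K * \<eta>" by (simp add: mult.commute)
    have "infnorm Y \<le> infnorm B + infnorm (\<eta> *\<^sub>R (G ** P)) + infnorm (\<tau> *\<^sub>R (G - G ** P))"
      unfolding Y_def by (meson add_right_mono infnorm_triangle order_trans)
    also have "\<dots> = infnorm B + \<eta> * infnorm (G ** P) + \<tau> * infnorm (G - G ** P)"
      using \<eta> \<tau> by (simp add: infnorm_mul)
    also have "\<dots> \<le> (1 + \<tau>) * infnorm B + (1 + \<tau>) * infnorm (G ** P) + (1 + \<tau>) * infnorm (G - G ** P)"
      using \<eta> \<tau> infnorm_pos_le[of B] mult_right_mono[of 1 "1 + \<tau>" "infnorm B"]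
      by (intro add_mono mult_right_mono infnorm_pos_le) auto
    also have "\<dots> = (infnorm B + infnorm (G ** P) + infnorm (G - G ** P)) * (1 + \<tau>)"
      by (simp add: algebra_simps)
    also have "\<dots> \<le> K * (1 + \<tau>)" using K0 \<tau> by (intro mult_right_mono) auto
    finally have Y2: "infnorm Y \<le> K * (1 + \<tau>)" .
    have "det (Y + E) \<noteq> 0" if E: "infnorm (E ** x) * K \<le> \<eta>" "infnorm E * K \<le> \<tau>" for E
    proof -
      have "v = 0" if "(Y + E) *v v = 0" for v
      proof (rule ccontr)
        assume "v \<noteq> 0"
        define r where "r = v - P *v v"
        \<comment> \<open>Stretching \<open>r\<close> by \<open>\<tau> / \<eta>\<close> turns
          \<open>Y *v v\<close> into \<open>B *v w + \<eta> *\<^sub>R g w\<close>, to which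
          \<open>gc\<close> applies.\<close>
        define w where "w = P *v v + (\<tau> / \<eta>) *\<^sub>R r"
        have x'r: "x' *v r = 0" by (simp add: r_def P matrix_vector_mult_diff_distrib x'x)
        have x'w: "x' *v w = x' *v v"
          by (simp add: w_def matrix_vector_right_distrib matrix_vector_mult_scaleR x'r P x'x)
        have "w \<noteq> 0"
        proof
          assume "w = 0"
          then have "x' *v v = 0" using x'w by simp
          then have "P *v v = 0" by (simp add: P)
          then have "w = (\<tau> / \<eta>) *\<^sub>R v" by (simp add: w_def r_def)
          then show False using \<open>w = 0\<close> \<open>v \<noteq> 0\<close> \<eta> \<tau> by simp
        qed
        \<comment> \<open>Hence \<open>r\<close> has size O(\<eta>/\<tau>) relative to
          \<open>w\<close>, which compensates for the weaker tolerance \<open>\<tau>\<close> on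
          \<open>E\<close>.\<close>
        have wr: "w - P *v w = (\<tau> / \<eta>) *\<^sub>R r"
          by (simp add: P x'w) (simp add: w_def P)
        have "Y *v v = B *v w + \<eta> *\<^sub>R g w"
          using \<eta> by (simp add: Yv B x'w) (simp add: w_def linear_add[OF g] linear_cmul[OF g] r_def scaleR_add_right)
        then have lower: "c * \<eta> * norm w \<le> norm (Y *v v)" using gc[OF \<eta>] by simp
        have "E *v v = E *v (P *v v) + E *v r"
          by (simp add: r_def flip: matrix_vector_right_distrib)
        also have "E *v (P *v v) = (E ** x) *v (x' *v w)"
          by (simp add: P x'w flip: matrix_vector_mul_assoc)
        finally have "norm (E *v v) \<le> norm ((E ** x) *v (x' *v w)) + norm (E *v r)"
          using norm_triangle_ineq by simp
        moreover have "norm ((E ** x) *v (x' *v w)) \<le> N1 * (\<eta> / K) * (M1 * norm w)"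
        proof -
          have "infnorm (E ** x) \<le> \<eta> / K" using E(1) \<open>0 < K\<close> by (simp add: field_simps)
          then have "N1 * infnorm (E ** x) * norm (x' *v w) \<le> N1 * (\<eta> / K) * (M1 * norm w)"
            using M1(2)[of w] M1(1) N1(1) \<eta> \<open>0 < K\<close> infnorm_pos_le[of "E ** x"]
            by (intro mult_mono) auto
          then show ?thesis using N1(2) order_trans by blast
        qed
        moreover have "norm (E *v r) \<le> N2 * (\<tau> / K) * (\<eta> / \<tau> * (M2 * norm w))"
        proof -
          have "infnorm E \<le> \<tau> / K" using E(2) \<open>0 < K\<close> by (simp add: field_simps)
          moreover have "norm r \<le> \<eta> / \<tau> * (M2 * norm w)"
            using M2(2)[of w] \<eta> \<tau> unfolding wr by (simp add: field_simps)
          ultimately have "N2 * infnorm E * norm r \<le> N2 * (\<tau> / K) * (\<eta> / \<tau> * (M2 * norm w))"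
            using N2(1) \<tau> \<open>0 < K\<close> infnorm_pos_le[of E] by (intro mult_mono) auto
          then show ?thesis using N2(2) order_trans by blast
        qed
        ultimately have "norm (E *v v) \<le> N1 * (\<eta> / K) * (M1 * norm w) + N2 * (\<tau> / K) * (\<eta> / \<tau> * (M2 * norm w))"
          by linarith
        also have "\<dots> = (N1 * M1 + N2 * M2) * (\<eta> * norm w / K)"
          using \<tau> \<open>0 < K\<close> by (simp add: field_simps)
        also have "\<dots> < (c * K) * (\<eta> * norm w / K)"
          using Kc \<eta> \<open>0 < K\<close> \<open>w \<noteq> 0\<close> by (intro mult_strict_right_mono) auto
        also have "\<dots> = c * \<eta> * norm w" using \<open>0 < K\<close> by simp
        finally have "norm (E *v v) < norm (Y *v v)" using lower by linarith
        moreover have "Y *v v = - (E *v v)"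
          using that by (simp add: matrix_vector_mult_add_rdistrib add_eq_0_iff)
        ultimately show False by simp
      qed
      then have "invertible (Y + E)"
        using matrix_left_invertible_ker invertible_left_inverse by blast
      then show ?thesis by (simp add: invertible_det_nz)
    qed
    then show "\<exists>Y. infnorm (Y ** x - y) \<le> K * \<eta> \<and> infnorm Y \<le> K * (1 + \<tau>) \<and>
       (\<forall>E. infnorm (E ** x) * K \<le> \<eta> \<longrightarrow> infnorm E * K \<le> \<tau> \<longrightarrow> det (Y + E) \<noteq> 0)"
      using Y1 Y2 by blast
  qed
qed

text \<open>The determinant is continuous along the segment, so a change of sign would produce a
  zero.\<close>

lemma det_sgn_eq_of_segment:
  fixes Y E :: "real ^ 'n ^ 'n"
  assumes "\<And>s. 0 \<le> s \<Longrightarrow> s \<le> 1 \<Longrightarrow> det (Y + s *\<^sub>R E) \<noteq> 0"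
  shows "det (Y + E) > 0 \<longleftrightarrow> det Y > 0"
proof -
  have cont: "continuous_on {0..1} (\<lambda>s. det (Y + s *\<^sub>R E))"
    unfolding det_def by (intro continuous_intros)
  have "\<not> (det Y \<le> 0 \<and> 0 \<le> det (Y + E))"
    using IVT'[of "\<lambda>s. det (Y + s *\<^sub>R E)" 0 0 1, OF _ _ _ cont] assms by auto
  moreover have "\<not> (det (Y + E) \<le> 0 \<and> 0 \<le> det Y)"
    using IVT2'[of "\<lambda>s. det (Y + s *\<^sub>R E)" 1 0 0, OF _ _ _ cont] assms by auto
  ultimately show ?thesis by linarith
qed

text \<open>The allowed perturbations are star-shaped about 0, so \<open>det (Y + E)\<close> keeps
  the sign of \<open>det Y\<close>. If that sign is wrong, \<open>Y\<close> is replaced by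
  \<open>Y ** \<rho>\<close>, where the reflection \<open>\<rho>\<close> fixes the columns of
  \<open>x\<close> and hence leaves \<open>Y ** x\<close> unchanged; it exists because these columns
  do not span the space.\<close>

lemma exists_robust_positive_det:
  fixes x y :: "real ^ 'p ^ 'n"
  assumes x: "lin_indep_columns x" and pn: "CARD('p) < CARD('n)"
  obtains K where "K > 0"
    "\<And>\<eta> \<tau>. \<lbrakk>0 < \<eta>; \<eta> \<le> 1; 0 < \<tau>\<rbrakk> \<Longrightarrow> \<exists>Y. infnorm (Y ** x - y) \<le> K * \<eta> \<and> infnorm Y \<le> K * (1 + \<tau>) \<and>
       (\<forall>E. infnorm (E ** x) * K \<le> \<eta> \<longrightarrow> infnorm E * K \<le> \<tau> \<longrightarrow> det (Y + E) > 0)"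
proof -
  obtain K where "K > 0" and K:
    "\<And>\<eta> \<tau>. \<lbrakk>0 < \<eta>; \<eta> \<le> 1; 0 < \<tau>\<rbrakk> \<Longrightarrow> \<exists>Y. infnorm (Y ** x - y) \<le> K * \<eta> \<and> infnorm Y \<le> K * (1 + \<tau>) \<and>
       (\<forall>E. infnorm (E ** x) * K \<le> \<eta> \<longrightarrow> infnorm E * K \<le> \<tau> \<longrightarrow> det (Y + E) \<noteq> 0)"
    using exists_robust_invertible[OF x] by blast
  have "dim (columns x) < DIM(real ^ 'n)"
    using rank_bound[of x] pn by (simp add: column_rank_def)
  then obtain v where v: "v \<noteq> 0" "\<And>z. z \<in> span (columns x) \<Longrightarrow> orthogonal v z"
    using orthogonal_to_subspace_exists by blast
  obtain \<rho> :: "real ^ 'n ^ 'n" where \<rho>: "det \<rho> = -1" "\<And>z. orthogonal v z \<Longrightarrow> \<rho> *v z = z"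
    using exists_reflection_matrix[OF v(1)] by blast
  have "\<rho> *v (x *v t) = x *v t" for t
    by (intro \<rho>(2) v(2) matrix_vector_mult_in_columnspace)
  then have \<rho>x: "\<rho> ** x = x" by (simp add: matrix_eq flip: matrix_vector_mul_assoc)
  obtain \<rho>' where \<rho>': "\<rho> ** \<rho>' = mat 1" "\<rho>' ** \<rho> = mat 1"
    using \<rho>(1) invertible_det_nz[of \<rho>] by (auto simp: invertible_def)
  have \<rho>'x: "\<rho>' ** x = x" by (metis \<rho>x \<rho>'(2) matrix_mul_assoc matrix_mul_lid)
  obtain C1 where C1: "C1 > 0" "\<And>A :: real ^ 'n ^ 'n. infnorm (A ** \<rho>) \<le> C1 * infnorm A"
    using linear_infnorm_bound[OF linear_matrix_mult_right] by blast
  obtain C2 where C2: "C2 > 0" "\<And>A :: real ^ 'n ^ 'n. infnorm (A ** \<rho>') \<le> C2 * infnorm A"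
    using linear_infnorm_bound[OF linear_matrix_mult_right] by blast
  \<comment> \<open>\<open>C1\<close> accounts for the size of \<open>Y ** \<rho>\<close>,
    \<open>C2\<close> for that of the perturbation \<open>E ** \<rho>'\<close>.\<close>
  define K' where "K' = K * (1 + C1 + C2)"
  have K': "K' > 0" "K \<le> K'" "K * C1 \<le> K'" "K * C2 \<le> K'"
    using \<open>K > 0\<close> C1(1) C2(1) by (simp_all add: K'_def algebra_simps add_pos_pos)
  show ?thesis
  proof (rule that[OF K'(1)])
    fix \<eta> \<tau> :: real assume \<eta>: "0 < \<eta>" "\<eta> \<le> 1" and \<tau>: "0 < \<tau>"
    obtain Y where Y: "infnorm (Y ** x - y) \<le> K * \<eta>" "infnorm Y \<le> K * (1 + \<tau>)"
       "\<And>E. infnorm (E ** x) * K \<le> \<eta> \<Longrightarrow> infnorm E * K \<le> \<tau> \<Longrightarrow> det (Y + E) \<noteq> 0"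
      using K[OF \<eta> \<tau>] by blast
    have sgn: "det (Y + E) > 0 \<longleftrightarrow> det Y > 0"
      if E: "infnorm (E ** x) * K \<le> \<eta>" "infnorm E * K \<le> \<tau>" for E
    proof (rule det_sgn_eq_of_segment, rule Y(3))
      fix s :: real assume s: "0 \<le> s" "s \<le> 1"
      have "infnorm ((s *\<^sub>R E) ** x) = s * infnorm (E ** x)"
        using s by (simp add: linear_cmul[OF linear_matrix_mult_right] infnorm_mul)
      then show "infnorm ((s *\<^sub>R E) ** x) * K \<le> \<eta>"
        using E(1) s mult_left_le_one_le[of "infnorm (E ** x) * K" s] \<open>K > 0\<close> infnorm_pos_le[of "E ** x"]
        by (simp add: mult.assoc)
      show "infnorm (s *\<^sub>R E) * K \<le> \<tau>"
        using E(2) s mult_left_le_one_le[of "infnorm E * K" s] \<open>K > 0\<close> infnorm_pos_le[of E]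
        by (simp add: infnorm_mul mult.assoc)
    qed
    show "\<exists>Y. infnorm (Y ** x - y) \<le> K' * \<eta> \<and> infnorm Y \<le> K' * (1 + \<tau>) \<and>
       (\<forall>E. infnorm (E ** x) * K' \<le> \<eta> \<longrightarrow> infnorm E * K' \<le> \<tau> \<longrightarrow> det (Y + E) > 0)"
    proof (cases "det Y > 0")
      case True
      have "det (Y + E) > 0" if "infnorm (E ** x) * K' \<le> \<eta>" "infnorm E * K' \<le> \<tau>" for E
      proof -
        have "infnorm (E ** x) * K \<le> \<eta>" "infnorm E * K \<le> \<tau>"
          using that K'(2) mult_left_mono[OF K'(2) infnorm_pos_le] order_trans by blast+
        then show ?thesis using sgn True by blast
      qed
      moreover have "infnorm (Y ** x - y) \<le> K' * \<eta>" "infnorm Y \<le> K' * (1 + \<tau>)"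
        using Y(1,2) mult_right_mono[OF K'(2), of \<eta>] mult_right_mono[OF K'(2), of "1 + \<tau>"] \<eta> \<tau> by linarith+
      ultimately show ?thesis by blast
    next
      case False
      \<comment> \<open>Perturbing \<open>Y ** \<rho>\<close> by \<open>E\<close> is perturbing
        \<open>Y\<close> by \<open>E ** \<rho>'\<close> and then applying \<open>\<rho>\<close>,
        which reverses the sign.\<close>
      have "det (Y ** \<rho> + E) > 0" if E: "infnorm (E ** x) * K' \<le> \<eta>" "infnorm E * K' \<le> \<tau>" for E
      proof -
        have "infnorm ((E ** \<rho>') ** x) * K \<le> \<eta>"
          using E(1) mult_left_mono[OF K'(2) infnorm_pos_le[of "E ** x"]]
          by (simp add: \<rho>'x flip: matrix_mul_assoc)
        moreover have "infnorm (E ** \<rho>') * K \<le> \<tau>"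
        proof -
          have "infnorm (E ** \<rho>') * K \<le> infnorm E * (K * C2)"
            using mult_right_mono[OF C2(2)[of E], of K] \<open>K > 0\<close> by (simp add: algebra_simps)
          also have "\<dots> \<le> infnorm E * K'" using K'(4) by (intro mult_left_mono infnorm_pos_le)
          finally show ?thesis using E(2) by linarith
        qed
        ultimately have "\<not> det (Y + E ** \<rho>') > 0" "det (Y + E ** \<rho>') \<noteq> 0"
          using sgn False Y(3) by blast+
        then have "det ((Y + E ** \<rho>') ** \<rho>) > 0" by (simp add: det_mul \<rho>(1))
        moreover have "(Y + E ** \<rho>') ** \<rho> = Y ** \<rho> + E"
          by (simp add: linear_add[OF linear_matrix_mult_right] \<rho>'(2) flip: matrix_mul_assoc)
        ultimately show ?thesis by simp
      qed
      moreover have "infnorm ((Y ** \<rho>) ** x - y) \<le> K' * \<eta>"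
        using order_trans[OF Y(1) mult_right_mono[OF K'(2), of \<eta>]] \<eta>
        by (simp add: \<rho>x flip: matrix_mul_assoc)
      moreover have "infnorm (Y ** \<rho>) \<le> K' * (1 + \<tau>)"
      proof -
        have "infnorm (Y ** \<rho>) \<le> C1 * (K * (1 + \<tau>))"
          using C1(2)[of Y] mult_left_mono[OF Y(2), of C1] C1(1) by linarith
        also have "\<dots> \<le> K' * (1 + \<tau>)"
          using mult_right_mono[OF K'(3), of "1 + \<tau>"] \<tau> by (simp add: algebra_simps)
        finally show ?thesis .
      qed
      ultimately show ?thesis by blast
    qed
  qed
qed

subsection \<open>From homogeneous to inhomogeneous approximation\<close>

lemma int_matrices_eq_int_points: "(int_matrices :: (real ^ 'n ^ 'n) set) = int_points"
  by (auto simp: int_matrices_def int_points_def Basis_vec_def inner_axis)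

lemma infnorm_int_matrices_ge_1:
  assumes "\<omega> \<in> int_matrices - {0}"
  shows "infnorm \<omega> \<ge> 1"
proof -
  obtain i j where ij: "\<omega> $ i $ j \<noteq> 0"
    using assms by (auto simp: vec_eq_iff)
  moreover have "\<omega> $ i $ j \<in> \<int>" using assms by (simp add: int_matrices_def)
  ultimately have "1 \<le> \<bar>\<omega> $ i $ j\<bar>" using Ints_nonzero_abs_ge1 by blast
  also have "\<bar>\<omega> $ i $ j\<bar> \<le> infnorm \<omega>"
    unfolding infnorm_matrix_eq_Max by (rule Max_ge) auto
  finally show ?thesis .
qed

text \<open>The admissibility of \<open>u\<close> in \<open>hom_exponent\<close>, with
  \<open>c\<close> exposed because the covering constants depend on it.\<close>

definition hom_bound :: "real ^ 'p ^ 'n \<Rightarrow> real \<Rightarrow> real \<Rightarrow> bool" where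
  "hom_bound x u c \<longleftrightarrow> c > 0 \<and>
     (\<forall>\<omega> \<in> int_matrices - {0}. infnorm (\<omega> ** x) > c * infnorm \<omega> powr (- u))"

text \<open>The covering lemma is applied with \<open>a = c * b powr (- u)\<close>: as
  \<open>u\<close> is nonnegative, \<open>hom_bound\<close> keeps nonzero integer matrices out of
  the body. The product of powers is then \<open>c ^ P * b powr (- e)\<close>, so division by it
  multiplies \<open>b\<close> and \<open>a\<close> by O(b^e). Its boundedness for large
  \<open>b\<close> forces \<open>e \<ge> 0\<close>.\<close>

lemma hom_bound_covering:
  fixes x :: "real ^ 'p ^ 'n"
  assumes hb: "hom_bound x u c" and u: "0 \<le> u" and pn: "CARD('p) \<le> CARD('n)"
  defines "e \<equiv> real CARD('n) * real CARD('p) * u - real CARD('n) * (real CARD('n) - real CARD('p))"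
  obtains C b0 where "C > 0" "b0 \<ge> 1" "e \<ge> 0"
    "\<And>b Z. b \<ge> b0 \<Longrightarrow> \<exists>\<gamma>\<in>int_matrices. infnorm (Z - \<gamma>) \<le> C * b powr (e + 1) \<and>
       infnorm ((Z - \<gamma>) ** x) \<le> C * b powr (e - u)"
proof -
  define P where "P = CARD('n) * CARD('p)"
  define D where "D = CARD('n) * CARD('n)"
  have dims: "DIM(real ^ 'p ^ 'n) = P" "DIM(real ^ 'n ^ 'n) = D" by (simp_all add: P_def D_def)
  have PD: "P \<le> D" using pn by (simp add: P_def D_def)
  have lin: "linear (\<lambda>A :: real ^ 'n ^ 'n. A ** x)" by (rule linear_matrix_mult_right)
  obtain C where "C > 0" and C:
    "\<And>a b (z :: real ^ 'n ^ 'n). \<lbrakk>0 < a; a \<le> b; 1 \<le> b;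
       \<And>q :: real ^ 'n ^ 'n. \<lbrakk>q \<in> int_points; infnorm q \<le> b; infnorm (q ** x) \<le> a\<rbrakk> \<Longrightarrow> q = 0\<rbrakk>
     \<Longrightarrow> a ^ P * b ^ (D - P) \<le> C \<and>
       (\<exists>q\<in>int_points. infnorm (z - q) * (a ^ P * b ^ (D - P)) \<le> C * b \<and>
          infnorm ((z - q) ** x) * (a ^ P * b ^ (D - P)) \<le> C * a)"
    using int_points_covering[OF lin, unfolded dims, OF PD] by metis
  have c: "c > 0" using hb by (simp add: hom_bound_def)
  have e: "e = u * real P - real (D - P)"
    using PD by (simp add: e_def P_def D_def of_nat_diff algebra_simps)
  have main: "c ^ P * b powr (- e) \<le> C \<and> (\<exists>q\<in>int_matrices. infnorm (Z - q) * (c ^ P * b powr (- e)) \<le> C * b \<and>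
     infnorm ((Z - q) ** x) * (c ^ P * b powr (- e)) \<le> C * (c * b powr (- u)))"
    if b: "b \<ge> max 1 c" for b and Z :: "real ^ 'n ^ 'n"
  proof -
    have b1: "1 \<le> b" "c \<le> b" using b by auto
    define a where "a = c * b powr (- u)"
    have "b powr (- u) \<le> b powr 0" using b1 u by (intro powr_mono) auto
    then have "a \<le> c * 1" unfolding a_def using c b1 by (intro mult_left_mono) auto
    then have ab: "0 < a" "a \<le> b" using c b1(2) \<open>1 \<le> b\<close> by (simp add: a_def, linarith)
    have pt: "q = 0" if q: "q \<in> int_points" "infnorm q \<le> b" "infnorm (q ** x) \<le> a" for q :: "real ^ 'n ^ 'n"
    proof (rule ccontr)
      assume "q \<noteq> 0"
      then have qI: "q \<in> int_matrices - {0}" using q(1) by (simp add: int_matrices_eq_int_points)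
      have "b powr (- u) \<le> infnorm q powr (- u)"
        using infnorm_int_matrices_ge_1[OF qI] q(2) u by (intro powr_mono2') auto
      then have "a \<le> c * infnorm q powr (- u)" unfolding a_def using c by simp
      also have "\<dots> < infnorm (q ** x)" using hb qI by (simp add: hom_bound_def)
      finally show False using q(3) by simp
    qed
    have "a ^ P * b ^ (D - P) = c ^ P * b powr (- e)"
      using b1 by (simp add: a_def e power_mult_distrib powr_powr powr_add[symmetric]
          flip: powr_realpow)
    then show ?thesis
      using C[OF ab b1(1) pt, of Z] unfolding a_def int_matrices_eq_int_points by simp
  qed
  have "e \<ge> 0"
  proof (rule ccontr)
    assume "\<not> e \<ge> 0"
    then have e0: "- e > 0" by simp
    \<comment> \<open>Large enough for \<open>c ^ P * b powr (- e)\<close> to reach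
      \<open>2 * C\<close>, against the bound \<open>C\<close>.\<close>
    define b where "b = max (max 1 c) ((2 * C / c ^ P) powr (1 / - e))"
    have "2 * C / c ^ P = ((2 * C / c ^ P) powr (1 / - e)) powr (- e)"
      using e0 \<open>C > 0\<close> c by (simp add: powr_powr)
    also have "\<dots> \<le> b powr (- e)"
      using e0 by (intro powr_mono2) (auto simp: b_def)
    finally have "2 * C \<le> c ^ P * b powr (- e)" using c by (simp add: field_simps)
    also have "\<dots> \<le> C" using main[of b] by (simp add: b_def)
    finally show False using \<open>C > 0\<close> by simp
  qed
  define C' where "C' = C * (1 + c) / c ^ P"
  show ?thesis
  proof (rule that[of C' "max 1 c"])
    show "C' > 0" using \<open>C > 0\<close> c by (simp add: C'_def)
    fix b and Z :: "real ^ 'n ^ 'n" assume b: "b \<ge> max 1 c"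
    then have b1: "b \<ge> 1" by simp
    obtain q where q: "q \<in> int_matrices" "infnorm (Z - q) * (c ^ P * b powr (- e)) \<le> C * b"
      "infnorm ((Z - q) ** x) * (c ^ P * b powr (- e)) \<le> C * (c * b powr (- u))"
      using main[OF b] by blast
    \<comment> \<open>Serves both norms: \<open>k = 1\<close>, \<open>s = 1\<close> for the matrix
      and \<open>k = c\<close>, \<open>s = - u\<close> for its product with
      \<open>x\<close>.\<close>
    have *: "r \<le> C' * b powr (e + s)"
      if "r * (c ^ P * b powr (- e)) \<le> C * (k * b powr s)" "k \<le> 1 + c" for r s k
    proof -
      have "r = (r * (c ^ P * b powr (- e))) * (b powr e / c ^ P)"
        using c b1 by (simp add: powr_minus field_simps)
      also have "\<dots> \<le> (C * ((1 + c) * b powr s)) * (b powr e / c ^ P)"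
      proof (rule mult_right_mono)
        have "C * (k * b powr s) \<le> C * ((1 + c) * b powr s)"
          using that(2) \<open>C > 0\<close> by (intro mult_left_mono mult_right_mono) auto
        then show "r * (c ^ P * b powr (- e)) \<le> C * ((1 + c) * b powr s)" using that(1) by linarith
      qed (use c in simp)
      also have "\<dots> = C' * b powr (e + s)" by (simp add: C'_def powr_add)
      finally show ?thesis .
    qed
    have "infnorm (Z - q) \<le> C' * b powr (e + 1)" using *[of _ 1 1] q(2) b1 c by simp
    moreover have "infnorm ((Z - q) ** x) \<le> C' * b powr (e - u)" using *[of _ c "- u"] q(3) by simp
    ultimately show "\<exists>\<gamma>\<in>int_matrices. infnorm (Z - \<gamma>) \<le> C' * b powr (e + 1) \<and>
       infnorm ((Z - \<gamma>) ** x) \<le> C' * b powr (e - u)"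
      using q(1) by blast
  qed (use \<open>e \<ge> 0\<close> in auto)
qed

text \<open>The Dirichlet lower bound for the exponent, obtained by rewriting
  \<open>e \<ge> 0\<close>.\<close>

lemma hom_bound_exponent_ge:
  fixes x :: "real ^ 'p ^ 'n"
  assumes hb: "hom_bound x u c" and pn: "CARD('p) < CARD('n)"
  shows "u \<ge> (real CARD('n) - real CARD('p)) / real CARD('p)"
proof -
  have ge: "v \<ge> (real CARD('n) - real CARD('p)) / real CARD('p)" if "hom_bound x v c" "0 \<le> v" for v
  proof -
    have "0 \<le> real CARD('n) * real CARD('p) * v - real CARD('n) * (real CARD('n) - real CARD('p))"
      using hom_bound_covering[OF that less_imp_le[OF pn]] by blast
    then have "0 \<le> real CARD('n) * (real CARD('p) * v - (real CARD('n) - real CARD('p)))"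
      by (simp add: algebra_simps)
    then have "0 \<le> real CARD('p) * v - (real CARD('n) - real CARD('p))"
      by (simp add: zero_le_mult_iff)
    then show ?thesis by (simp add: field_simps)
  qed
  show ?thesis
  proof (cases "0 \<le> u")
    case True
    then show ?thesis using ge hb by blast
  next
    case False
    \<comment> \<open>Nonzero integer matrices have norm at least 1, so a negative admissible
      \<open>u\<close> would make 0 admissible, below the positive bound already shown.\<close>
    have "hom_bound x 0 c"
      unfolding hom_bound_def
    proof (intro conjI ballI)
      show "c > 0" using hb by (simp add: hom_bound_def)
      fix \<omega> :: "real ^ 'n ^ 'n" assume \<omega>: "\<omega> \<in> int_matrices - {0}"
      have "infnorm \<omega> powr (- 0) \<le> infnorm \<omega> powr (- u)"
        using infnorm_int_matrices_ge_1[OF \<omega>] False by (intro powr_mono) auto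
      then have "c * infnorm \<omega> powr (- 0) \<le> c * infnorm \<omega> powr (- u)"
        using \<open>c > 0\<close> by (intro mult_left_mono) auto
      also have "\<dots> < infnorm (\<omega> ** x)" using hb \<omega> by (simp add: hom_bound_def)
      finally show "c * infnorm \<omega> powr (- 0) < infnorm (\<omega> ** x)" .
    qed
    then have "0 \<ge> (real CARD('n) - real CARD('p)) / real CARD('p)" using ge by blast
    moreover have "0 < (real CARD('n) - real CARD('p)) / real CARD('p)" using pn by simp
    ultimately show ?thesis by linarith
  qed
qed

text \<open>An integer matrix near a robust centre \<open>Y\<close> inherits a positive determinant
  once \<open>\<eta>\<close> and \<open>\<tau>\<close> are \<open>K\<close> times the two covering
  errors. Taking \<open>b powr (- \<alpha>)\<close> proportional to \<epsilon> gives norm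
  O(\<epsilon>^(-\<beta>/\<alpha>)); the surplus of \<psi> over \<beta>/\<alpha> absorbs the
  constant for small \<epsilon>.\<close>

lemma hom_bound_approximation:
  fixes x y :: "real ^ 'p ^ 'n"
  assumes x: "lin_indep_columns x" and pn: "CARD('p) < CARD('n)" and hb: "hom_bound x u c" and u: "0 \<le> u"
  defines "e \<equiv> real CARD('n) * real CARD('p) * u - real CARD('n) * (real CARD('n) - real CARD('p))"
  assumes eu: "e < u" and \<psi>: "(e + 1) / (u - e) < \<psi>"
  shows "\<exists>\<epsilon>\<^sub>0. 0 < \<epsilon>\<^sub>0 \<and> \<epsilon>\<^sub>0 \<le> 1 \<and> (\<forall>\<epsilon> \<in> {0<..<\<epsilon>\<^sub>0}. \<exists>\<gamma> \<in> \<Gamma>.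
           infnorm (\<gamma> ** x - y) < \<epsilon> \<and> infnorm \<gamma> < \<epsilon> powr (- \<psi>))"
proof -
  obtain C b0 where C: "C > 0" and b0: "b0 \<ge> 1" and e: "e \<ge> 0"
    and cov: "\<And>b Z. b \<ge> b0 \<Longrightarrow> \<exists>\<gamma>\<in>int_matrices. infnorm (Z - \<gamma>) \<le> C * b powr (e + 1) \<and>
       infnorm ((Z - \<gamma>) ** x) \<le> C * b powr (e - u)"
    using hom_bound_covering[OF hb u less_imp_le[OF pn]] unfolding e_def by metis
  obtain K where K: "K > 0" and rob:
    "\<And>\<eta> \<tau>. \<lbrakk>0 < \<eta>; \<eta> \<le> 1; 0 < \<tau>\<rbrakk> \<Longrightarrow> \<exists>Y. infnorm (Y ** x - y) \<le> K * \<eta> \<and> infnorm Y \<le> K * (1 + \<tau>) \<and>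
       (\<forall>E. infnorm (E ** x) * K \<le> \<eta> \<longrightarrow> infnorm E * K \<le> \<tau> \<longrightarrow> det (Y + E) > 0)"
    using exists_robust_positive_det[OF x pn] by blast
  define \<alpha> \<beta> where "\<alpha> = u - e" and "\<beta> = e + 1"
  have \<alpha>: "\<alpha> > 0" and \<beta>: "\<beta> > 0" using eu e by (auto simp: \<alpha>_def \<beta>_def)
  \<comment> \<open>Twice the constant in the total error, so that the error is at most \<epsilon>/2
    and the inequality is strict.\<close>
  define M where "M = 2 * (K * (K * C) + C)"
  define M' where "M' = K + K * (K * C) + C"
  have M: "M > 0" and M': "M' > 0" using K C by (simp_all add: M_def M'_def add_pos_pos)
  define s where "s = \<psi> - \<beta> / \<alpha>"
  have s: "s > 0" using \<psi> by (simp add: s_def \<alpha>_def \<beta>_def)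
  define \<kappa> where "\<kappa> = 1 / (M' * M powr (\<beta> / \<alpha>))"
  have \<kappa>: "\<kappa> > 0" using M M' by (simp add: \<kappa>_def)
  \<comment> \<open>Apart from 1, the bounds ensure in turn
    \<open>\<epsilon> powr s < \<kappa>\<close>, \<open>b0 \<le> b\<close> and
    \<open>\<eta> \<le> 1\<close>.\<close>
  define \<epsilon>\<^sub>0 where "\<epsilon>\<^sub>0 = min (min 1 (\<kappa> powr (1 / s))) (min (M / b0 powr \<alpha>) (M / (K * C)))"
  show ?thesis
  proof (intro exI[of _ \<epsilon>\<^sub>0] conjI ballI)
    show "0 < \<epsilon>\<^sub>0" using \<kappa> M b0 K C by (simp add: \<epsilon>\<^sub>0_def)
    show "\<epsilon>\<^sub>0 \<le> 1" by (simp add: \<epsilon>\<^sub>0_def)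
    fix \<epsilon> assume "\<epsilon> \<in> {0<..<\<epsilon>\<^sub>0}"
    then have \<epsilon>: "0 < \<epsilon>" "\<epsilon> < \<kappa> powr (1 / s)" "\<epsilon> < M / b0 powr \<alpha>" "\<epsilon> < M / (K * C)"
      by (auto simp: \<epsilon>\<^sub>0_def)
    define b where "b = (M / \<epsilon>) powr (1 / \<alpha>)"
    have b_pow: "b powr t = (M / \<epsilon>) powr (t / \<alpha>)" for t by (simp add: b_def powr_powr)
    have "b0 = (b0 powr \<alpha>) powr (1 / \<alpha>)" using b0 \<alpha> by (simp add: powr_powr)
    also have "\<dots> \<le> b" unfolding b_def
      using \<epsilon> b0 \<alpha> M by (intro powr_mono2) (auto simp: field_simps)
    finally have b: "b \<ge> b0" .
    have bma: "b powr (- \<alpha>) = \<epsilon> / M"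
      using \<alpha> \<epsilon>(1) M by (simp add: b_pow powr_minus)
    have bb: "b powr \<beta> \<ge> 1" using b b0 \<beta> by (intro ge_one_powr_ge_zero) auto
    define \<eta> \<tau> where "\<eta> = K * (C * b powr (- \<alpha>))" and "\<tau> = K * (C * b powr \<beta>)"
    have "\<eta> > 0" "\<eta> \<le> 1" "\<tau> > 0"
      using K C M \<epsilon> b b0 unfolding \<eta>_def \<tau>_def bma by (auto simp: field_simps)
    then obtain Y where Y: "infnorm (Y ** x - y) \<le> K * \<eta>" "infnorm Y \<le> K * (1 + \<tau>)"
      "\<And>E. infnorm (E ** x) * K \<le> \<eta> \<Longrightarrow> infnorm E * K \<le> \<tau> \<Longrightarrow> det (Y + E) > 0"
      using rob by blast
    obtain \<gamma> where \<gamma>: "\<gamma> \<in> int_matrices" "infnorm (Y - \<gamma>) \<le> C * b powr \<beta>"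
      "infnorm ((Y - \<gamma>) ** x) \<le> C * b powr (- \<alpha>)"
      using cov[OF b, of Y] by (auto simp: \<alpha>_def \<beta>_def)
    define E where "E = \<gamma> - Y"
    have Ex: "E ** x = - ((Y - \<gamma>) ** x)"
      unfolding E_def linear_diff[OF linear_matrix_mult_right] by simp
    have E: "infnorm E \<le> C * b powr \<beta>" "infnorm (E ** x) \<le> C * b powr (- \<alpha>)"
      using \<gamma> infnorm_sub[of \<gamma> Y] unfolding Ex infnorm_neg by (simp_all add: E_def)
    have "det (Y + E) > 0"
      using E K by (intro Y(3)) (simp_all add: \<eta>_def \<tau>_def)
    then have "\<gamma> \<in> \<Gamma>" using \<gamma>(1) by (simp add: \<Gamma>_def E_def)
    moreover have "infnorm (\<gamma> ** x - y) < \<epsilon>"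
    proof -
      have "\<gamma> ** x - y = (Y ** x - y) + E ** x"
        unfolding E_def linear_diff[OF linear_matrix_mult_right] by simp
      then have "infnorm (\<gamma> ** x - y) \<le> infnorm (Y ** x - y) + infnorm (E ** x)"
        by (metis infnorm_triangle)
      also have "\<dots> \<le> K * \<eta> + C * b powr (- \<alpha>)"
        using Y(1) E(2) by simp
      also have "\<dots> = M / 2 * b powr (- \<alpha>)" by (simp add: M_def \<eta>_def algebra_simps)
      also have "\<dots> < \<epsilon>" using M \<epsilon>(1) by (simp add: bma)
      finally show ?thesis .
    qed
    moreover have "infnorm \<gamma> < \<epsilon> powr (- \<psi>)"
    proof -
      have "infnorm \<gamma> \<le> K * (1 + \<tau>) + C * b powr \<beta>"
        using infnorm_triangle[of Y E] Y(2) E(1) by (simp add: E_def)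
      also have "\<dots> = K * 1 + (K * (K * C) + C) * b powr \<beta>" by (simp add: \<tau>_def algebra_simps)
      also have "\<dots> \<le> K * b powr \<beta> + (K * (K * C) + C) * b powr \<beta>"
        using bb K by (intro add_right_mono mult_left_mono) auto
      also have "\<dots> = M' * b powr \<beta>" by (simp add: M'_def algebra_simps)
      also have "\<dots> = (M' * M powr (\<beta> / \<alpha>)) * \<epsilon> powr (- (\<beta> / \<alpha>))"
        using M \<epsilon>(1) by (simp add: b_pow powr_divide powr_minus field_simps)
      also have "\<dots> = \<epsilon> powr (- (\<beta> / \<alpha>)) / \<kappa>" by (simp add: \<kappa>_def)
      also have "\<dots> < \<epsilon> powr (- \<psi>)"
      proof -
        have "\<epsilon> powr s < (\<kappa> powr (1 / s)) powr s" using s \<epsilon> by (intro powr_less_mono2) auto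
        then have "\<epsilon> powr s < \<kappa>" using s \<kappa> by (simp add: powr_powr)
        then have "\<epsilon> powr s * \<epsilon> powr (- \<psi>) < \<kappa> * \<epsilon> powr (- \<psi>)"
          using \<epsilon>(1) by (intro mult_strict_right_mono) auto
        then have "\<epsilon> powr (- (\<beta> / \<alpha>)) < \<kappa> * \<epsilon> powr (- \<psi>)"
          by (simp add: s_def flip: powr_add)
        then show ?thesis using \<kappa> by (simp add: field_simps)
      qed
      finally show ?thesis .
    qed
    ultimately show "\<exists>\<gamma> \<in> \<Gamma>. infnorm (\<gamma> ** x - y) < \<epsilon> \<and> infnorm \<gamma> < \<epsilon> powr (- \<psi>)" by blast
  qed
qed

text \<open>If there were finitely many, their distances to \<open>y\<close>, all positive since
  \<open>y\<close> is outside the orbit, would have a positive minimum; approximating more closely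
  gives one more.\<close>

lemma infinite_approximations:
  fixes x y :: "real ^ 'p ^ 'n"
  assumes approx: "\<And>\<psi>. \<psi> > \<psi>\<^sub>0 \<Longrightarrow> \<exists>\<epsilon>\<^sub>0 > 0. \<forall>\<epsilon> \<in> {0<..<\<epsilon>\<^sub>0}. \<exists>\<gamma> \<in> \<Gamma>.
      infnorm (\<gamma> ** x - y) < \<epsilon> \<and> infnorm \<gamma> < \<epsilon> powr (- \<psi>)"
    and \<psi>\<^sub>0: "\<psi>\<^sub>0 > 0" and y: "y \<notin> {\<gamma> ** x | \<gamma>. \<gamma> \<in> \<Gamma>}" and \<rho>: "\<rho> < 1 / \<psi>\<^sub>0"
  shows "infinite {\<gamma> \<in> \<Gamma>. infnorm (\<gamma> ** x - y) < infnorm \<gamma> powr (- \<rho>)}"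
proof
  assume fin: "finite {\<gamma> \<in> \<Gamma>. infnorm (\<gamma> ** x - y) < infnorm \<gamma> powr (- \<rho>)}" (is "finite ?S")
  \<comment> \<open>A positive exponent is needed to form \<open>1 / \<rho>'\<close>, and \<rho> may
    be negative or zero; raising it only strengthens the inequality, as norms are at least
    1.\<close>
  define \<rho>' where "\<rho>' = max \<rho> (1 / (2 * \<psi>\<^sub>0))"
  have \<rho>': "0 < \<rho>'" "\<rho> \<le> \<rho>'" "\<rho>' < 1 / \<psi>\<^sub>0" using \<psi>\<^sub>0 \<rho> by (auto simp: \<rho>'_def field_simps less_max_iff_disj)
  then have "1 / \<rho>' > \<psi>\<^sub>0" using \<psi>\<^sub>0 by (simp add: field_simps)
  then obtain \<epsilon>\<^sub>0 where \<epsilon>\<^sub>0: "\<epsilon>\<^sub>0 > 0" "\<And>\<epsilon>. 0 < \<epsilon> \<Longrightarrow> \<epsilon> < \<epsilon>\<^sub>0 \<Longrightarrow>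
      \<exists>\<gamma> \<in> \<Gamma>. infnorm (\<gamma> ** x - y) < \<epsilon> \<and> infnorm \<gamma> < \<epsilon> powr (- (1 / \<rho>'))"
    using approx[of "1 / \<rho>'"] by auto
  \<comment> \<open>The inserted \<open>\<epsilon>\<^sub>0 / 2\<close> makes the set nonempty and
    keeps \<epsilon> in the allowed range.\<close>
  define \<epsilon> where "\<epsilon> = Min (insert (\<epsilon>\<^sub>0 / 2) ((\<lambda>\<gamma>. infnorm (\<gamma> ** x - y)) ` ?S))"
  have "0 < infnorm (\<gamma> ** x - y)" if "\<gamma> \<in> \<Gamma>" for \<gamma>
    using y that by (auto simp: infnorm_pos_lt)
  then have "0 < \<epsilon>" using fin \<epsilon>\<^sub>0(1) by (auto simp: \<epsilon>_def)
  moreover have "\<epsilon> \<le> \<epsilon>\<^sub>0 / 2" unfolding \<epsilon>_def using fin by (intro Min_le) auto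
  ultimately obtain \<gamma> where \<gamma>: "\<gamma> \<in> \<Gamma>" "infnorm (\<gamma> ** x - y) < \<epsilon>" "infnorm \<gamma> < \<epsilon> powr (- (1 / \<rho>'))"
    using \<epsilon>\<^sub>0 by (metis field_sum_of_halves less_add_same_cancel1 order_le_less_trans half_gt_zero)
  have "\<gamma> \<in> int_matrices - {0}"
    using \<gamma>(1) det_0[where 'n='n and 'a=real] by (auto simp: \<Gamma>_def mat_0)
  then have ge1: "infnorm \<gamma> \<ge> 1" by (rule infnorm_int_matrices_ge_1)
  have "\<epsilon> = (\<epsilon> powr (- (1 / \<rho>'))) powr (- \<rho>')"
    using \<open>0 < \<epsilon>\<close> \<rho>'(1) by (simp add: powr_powr)
  also have "\<dots> \<le> infnorm \<gamma> powr (- \<rho>')"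
    using \<gamma>(3) ge1 \<rho>'(1) by (intro powr_mono2') auto
  also have "\<dots> \<le> infnorm \<gamma> powr (- \<rho>)"
    using ge1 \<rho>'(2) by (intro powr_mono) auto
  finally have "\<gamma> \<in> ?S" using \<gamma> by simp
  then have "\<epsilon> \<le> infnorm (\<gamma> ** x - y)" unfolding \<epsilon>_def using fin by (intro Min_le) auto
  then show False using \<gamma>(2) by simp
qed

text \<open>With \<open>e u\<close> the covering exponent, \<open>\<psi>\<^sub>0\<close> is the
  value at \<open>u = h\<close> of \<open>(e u + 1) / (u - e u)\<close>, so by continuity an
  admissible \<open>u\<close> close to \<open>h\<close> suffices. A threshold on \<epsilon> appears
  because, for fixed \<psi>, an \<epsilon> close to 1 would confine the entries of \<gamma> to -1, 0
  and 1, while \<open>y\<close> is arbitrary.\<close>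

theorem corollary1p3:
  fixes x y :: "real ^ 'p ^ 'n" and n p :: nat and \<phi>\<^sub>0 \<psi>\<^sub>0 :: real
  assumes "n = CARD('n)" and "p = CARD('p)"
    and "2 \<le> n" and "1 \<le> p" and "p \<le> n - 1"
    and "lin_indep_columns x"
    and "hom_exponent x < ereal (real n * (real n - real p) / (real n * real p - 1))"
    and "\<phi>\<^sub>0 = real p / (real n - real p) * real_of_ereal (hom_exponent x) - 1"
    and "\<psi>\<^sub>0 = real p / (real n - real p) *
           ((1 + real n * (real n - real p) * \<phi>\<^sub>0) / (1 - (real n * real p - 1) * \<phi>\<^sub>0))"
  shows "(\<forall>\<psi> > \<psi>\<^sub>0. \<exists>\<epsilon>\<^sub>0. 0 < \<epsilon>\<^sub>0 \<and> \<epsilon>\<^sub>0 \<le> 1 \<and>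
            (\<forall>\<epsilon> \<in> {0<..<\<epsilon>\<^sub>0}. \<exists>\<gamma> \<in> \<Gamma>.
               infnorm (\<gamma> ** x - y) < \<epsilon> \<and> infnorm \<gamma> < \<epsilon> powr (- \<psi>))) \<and>
         (y \<notin> {\<gamma> ** x | \<gamma>. \<gamma> \<in> \<Gamma>} \<longrightarrow>
            (\<forall>\<rho> < 1 / \<psi>\<^sub>0. infinite {\<gamma> \<in> \<Gamma>. infnorm (\<gamma> ** x - y) < infnorm \<gamma> powr (- \<rho>)}))"
proof -
  have pn: "CARD('p) < CARD('n)" using assms(1-5) by linarith
  define N P where "N = real n" and "P = real p"
  have NP: "P \<ge> 1" "N - P \<ge> 1" "N \<ge> 2" using assms(3-5) by (auto simp: N_def P_def)
  have NP1: "N * P > 1" using NP mult_mono[of 2 N 1 P] by simp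
  define U where "U = {u. \<exists>c. hom_bound x u c}"
  have h_def: "hom_exponent x = Inf (ereal ` U)"
    unfolding hom_exponent_def U_def hom_bound_def by (intro arg_cong[where f = Inf]) auto
  have U_ge: "(N - P) / P \<le> u" if "u \<in> U" for u
    using that hom_bound_exponent_ge[OF _ pn] assms(1,2) by (auto simp: U_def N_def P_def)
  have "ereal ((N - P) / P) \<le> hom_exponent x"
    unfolding h_def by (rule Inf_greatest) (use U_ge in auto)
  \<comment> \<open>Lower bound and hypothesis make the exponent finite, so
    \<open>real_of_ereal\<close> returns its true value.\<close>
  then obtain h where h: "hom_exponent x = ereal h" "(N - P) / P \<le> h"
    using assms(7) by (cases "hom_exponent x") auto
  have h_less: "h < N * (N - P) / (N * P - 1)" using assms(7) by (simp add: h(1) N_def P_def)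
  define e where "e = (\<lambda>u. N * P * u - N * (N - P))"
  have eh0: "e h \<ge> 0"
  proof -
    have "e h = N * (P * h - (N - P))" by (simp add: e_def algebra_simps)
    moreover have "N - P \<le> P * h" using h(2) NP by (simp add: field_simps)
    ultimately show ?thesis using NP by simp
  qed
  \<comment> \<open>This is the hypothesis on the exponent, cleared of its denominator.\<close>
  have eh: "e h < h" using h_less NP1 by (simp add: e_def field_simps)
  have \<phi>\<^sub>0: "\<phi>\<^sub>0 = P / (N - P) * h - 1" using assms(8) by (simp add: h(1) N_def P_def)
  have \<phi>\<^sub>0_mult: "\<phi>\<^sub>0 * (N - P) = P * h - (N - P)" using NP by (simp add: \<phi>\<^sub>0 left_diff_distrib)
  have num: "1 + N * (N - P) * \<phi>\<^sub>0 = e h + 1"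
  proof -
    have "N * (N - P) * \<phi>\<^sub>0 = N * (\<phi>\<^sub>0 * (N - P))" by simp
    then show ?thesis unfolding \<phi>\<^sub>0_mult by (simp add: e_def algebra_simps)
  qed
  \<comment> \<open>The factor \<open>P / (N - P)\<close> here cancels the one in front of the
    fraction in \<open>\<psi>\<^sub>0\<close>.\<close>
  have den: "1 - (N * P - 1) * \<phi>\<^sub>0 = P / (N - P) * (h - e h)"
  proof -
    have "(1 - (N * P - 1) * \<phi>\<^sub>0) * (N - P) = (N - P) - (N * P - 1) * (\<phi>\<^sub>0 * (N - P))"
      by (simp add: algebra_simps)
    also have "\<dots> = P * (h - e h)" unfolding \<phi>\<^sub>0_mult by (simp add: e_def algebra_simps)
    finally show ?thesis using NP by (simp add: eq_divide_eq)
  qed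
  have \<psi>\<^sub>0: "\<psi>\<^sub>0 = (e h + 1) / (h - e h)"
    using assms(9) NP unfolding N_def[symmetric] P_def[symmetric] num den by simp
  have approx: "\<exists>\<epsilon>\<^sub>0. 0 < \<epsilon>\<^sub>0 \<and> \<epsilon>\<^sub>0 \<le> 1 \<and> (\<forall>\<epsilon> \<in> {0<..<\<epsilon>\<^sub>0}. \<exists>\<gamma> \<in> \<Gamma>.
               infnorm (\<gamma> ** x - y) < \<epsilon> \<and> infnorm \<gamma> < \<epsilon> powr (- \<psi>))" if "\<psi> > \<psi>\<^sub>0" for \<psi>
  proof -
    have cont: "isCont e h" unfolding e_def by (intro continuous_intros)
    have "isCont (\<lambda>u. (e u + 1) / (u - e u)) h"
      using cont eh by (intro continuous_intros) auto
    then have "\<forall>\<^sub>F u in at h. (e u + 1) / (u - e u) < \<psi>"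
      using that unfolding isCont_def \<psi>\<^sub>0 by (rule order_tendstoD(2))
    moreover have "isCont (\<lambda>u. u - e u) h" using cont by (intro continuous_intros)
    then have "\<forall>\<^sub>F u in at h. 0 < u - e u"
      using eh unfolding isCont_def by (intro order_tendstoD(1)) auto
    ultimately have "\<forall>\<^sub>F u in at h. e u < u \<and> (e u + 1) / (u - e u) < \<psi>"
      by eventually_elim auto
    then obtain d where d: "d > 0"
      "\<And>u. u \<noteq> h \<Longrightarrow> dist u h < d \<Longrightarrow> e u < u \<and> (e u + 1) / (u - e u) < \<psi>"
      unfolding eventually_at by auto
    have "Inf (ereal ` U) < ereal (h + d)" using d(1) h(1) by (simp add: h_def)
    then obtain u where u: "u \<in> U" "u < h + d" by (auto simp: Inf_less_iff)
    have "h \<le> u" using u(1) h(1) h_def by (metis Inf_lower ereal_less_eq(3) imageI)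
    \<comment> \<open>\<open>at h\<close> omits \<open>h\<close> itself, so the case of an attained
      infimum is treated directly.\<close>
    then have eu: "e u < u \<and> (e u + 1) / (u - e u) < \<psi>"
      using d(2)[of u] u(2) eh that \<psi>\<^sub>0 by (cases "u = h") (auto simp: dist_real_def)
    obtain c where c: "hom_bound x u c" using u(1) by (auto simp: U_def)
    have "0 \<le> (N - P) / P" using NP by simp
    then have "0 \<le> u" using U_ge[OF u(1)] by linarith
    then show ?thesis
      using hom_bound_approximation[OF assms(6) pn c, of \<psi> y] eu assms(1,2)
      by (simp add: e_def N_def P_def)
  qed
  have "\<psi>\<^sub>0 > 0" unfolding \<psi>\<^sub>0 using eh eh0 by simp
  then have "infinite {\<gamma> \<in> \<Gamma>. infnorm (\<gamma> ** x - y) < infnorm \<gamma> powr (- \<rho>)}"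
    if "y \<notin> {\<gamma> ** x | \<gamma>. \<gamma> \<in> \<Gamma>}" "\<rho> < 1 / \<psi>\<^sub>0" for \<rho>
    using infinite_approximations[of \<psi>\<^sub>0 x y \<rho>] approx that by blast
  with approx show ?thesis by blast
qed

end
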